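(* Let $T=(V,E)$ be a finite tree whose edges carry real (symmetric) positive definite $s\times s$ matrix weights, such that there is a unique Perron branch at every vertex of $T$. Then there is a unique pair of adjacent vertices $u\sim v$ in $T$ such that the Perron branch at $u$ is the branch containing $v$, while the Perron branch at $v$ is the branch containing $u$. Moreover, the unique Perron branch at any vertex $x$ of $T$ is the branch which contains at least one of the vertices $u$ or $v$.
   Context: Laplacian: for a tree $T=(V,E)$ on $n$ vertices with $s\times s$ matrix edge weights $W(e)$, $L=[l_{uv}]_{u,v\in V}$ is the $ns\times ns$ block matrix whose $s\times s$ blocks are: for $u\ne v$, $l_{uv}=-W(e)$ if $u,v$ are joined by the edge $e$, and $l_{uv}=\mathbf 0$ if $u,v$ are not adjacent; $l_{vv}$ is the sum of the weights of the edges incident with $v$. For $v\in V$, $L_v$ is $L$ with the row block and column block of $v$ deleted; it is invertible, and $M_v=L_v^{-1}$. A branch at $v$ is a connected component of the graph obtained from $T$ by deleting $v$ and its incident edges. $M_v$ is block diagonal with one diagonal block $M_v(B)$ (bottleneck matrix) for each branch $B$ at $v$; for $x,y\in B$ the $(x,y)$ block of $M_v(B)$ is $\sum_{e\in \mathcal P(x,v)\cap\mathcal P(y,v)}W(e)^{-1}$, where $\mathcal P(a,b)$ is the path joining $a$ and $b$. Write $\rho(\cdot)$ for spectral radius. A branch $B$ at $v$ is a Perron branch at $v$ if $\rho(M_v(B))=\rho(M_v)$, equivalently if $\rho(M_v(B))$ is the largest among all branches at $v$. *)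

theory Defs
  imports
    "Jordan_Normal_Form.Spectral_Radius"
    "Jordan_Normal_Form.DL_Submatrix"
    "Jordan_Normal_Form.Gauss_Jordan_Elimination"
    "Graph_Theory.Graph_Theory"
begin

text \<open>
  A finite simple graph is a \<open>pair_graph\<close>: every undirected edge is represented by the two
  opposite arcs. The library predicate \<open>tree\<close> is not usable here: it excludes all directed cycles,
  so that no such graph with an edge satisfies it. The back-and-forth walk along an edge is the
  only kind of \<open>cycle\<close> of length less than three; we therefore exclude cycles of length
  at least three.
\<close>

definition tree_graph :: "'a pair_pre_digraph \<Rightarrow> bool" where
  "tree_graph T \<longleftrightarrow> pair_graph T \<and> Digraph_Component.connected (with_proj T) \<and>
     \<not> (\<exists>p. pre_digraph.cycle (with_proj T) p \<and> 3 \<le> length p)"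

text \<open>
  The deleted graph is again symmetric, so its strongly connected components are its
  connected components. A branch is represented by its vertex set.
\<close>

definition branches :: "'a pair_pre_digraph \<Rightarrow> 'a \<Rightarrow> 'a set set" where
  "branches T v = pre_digraph.sccs_verts (pre_digraph.del_vert (with_proj T) v)"

definition pos_def_mat :: "nat \<Rightarrow> real mat \<Rightarrow> bool" where
  "pos_def_mat s A \<longleftrightarrow> A \<in> carrier_mat s s \<and> A\<^sup>T = A \<and>
     (\<forall>x \<in> carrier_vec s. x \<noteq> 0\<^sub>v s \<longrightarrow> 0 < x \<bullet> (A *\<^sub>v x))"

text \<open>
  Edge weights are given by a function \<open>W\<close> on unordered pairs \<open>{u, v}\<close>. The sum over the edges
  incident with \<open>v\<close> is written as a sum over the neighbours of \<open>v\<close>, entry by entry.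
\<close>

definition laplacian_block ::
  "'a pair_pre_digraph \<Rightarrow> ('a set \<Rightarrow> real mat) \<Rightarrow> nat \<Rightarrow> 'a \<Rightarrow> 'a \<Rightarrow> real mat" where
  "laplacian_block T W s u v =
     (if u = v then mat s s (\<lambda>(i, j). \<Sum>w | (v, w) \<in> parcs T. W {v, w} $$ (i, j))
      else if (u, v) \<in> parcs T then - W {u, v}
      else 0\<^sub>m s s)"

text \<open>
  The matrices below depend on an enumeration \<open>vs\<close> of the vertices: rows and columns
  \<open>k * s, \<dots>, k * s + s - 1\<close> form the row and column block of the vertex \<open>vs ! k\<close>.
\<close>

definition laplacian ::
  "'a pair_pre_digraph \<Rightarrow> ('a set \<Rightarrow> real mat) \<Rightarrow> nat \<Rightarrow> 'a list \<Rightarrow> real mat" where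
  "laplacian T W s vs = mat (length vs * s) (length vs * s)
     (\<lambda>(i, j). laplacian_block T W s (vs ! (i div s)) (vs ! (j div s)) $$ (i mod s, j mod s))"

definition block_indices :: "nat \<Rightarrow> 'a list \<Rightarrow> 'a set \<Rightarrow> nat set" where
  "block_indices s vs U = {i. i < length vs * s \<and> vs ! (i div s) \<in> U}"

definition principal_blocks :: "nat \<Rightarrow> 'a list \<Rightarrow> 'a set \<Rightarrow> real mat \<Rightarrow> real mat" where
  "principal_blocks s vs U A = submatrix A (block_indices s vs U) (block_indices s vs U)"

definition reduced_laplacian ::
  "'a pair_pre_digraph \<Rightarrow> ('a set \<Rightarrow> real mat) \<Rightarrow> nat \<Rightarrow> 'a list \<Rightarrow> 'a \<Rightarrow> real mat" where
  "reduced_laplacian T W s vs v = principal_blocks s vs (pverts T - {v}) (laplacian T W s vs)"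

definition inverse_reduced_laplacian ::
  "'a pair_pre_digraph \<Rightarrow> ('a set \<Rightarrow> real mat) \<Rightarrow> nat \<Rightarrow> 'a list \<Rightarrow> 'a \<Rightarrow> real mat" where
  "inverse_reduced_laplacian T W s vs v = the (mat_inverse (reduced_laplacian T W s vs v))"

text \<open>The blocks of the reduced matrices are enumerated by \<open>removeAll v vs\<close>.\<close>

definition bottleneck_matrix ::
  "'a pair_pre_digraph \<Rightarrow> ('a set \<Rightarrow> real mat) \<Rightarrow> nat \<Rightarrow> 'a list \<Rightarrow> 'a \<Rightarrow> 'a set \<Rightarrow> real mat" where
  "bottleneck_matrix T W s vs v B =
     principal_blocks s (removeAll v vs) B (inverse_reduced_laplacian T W s vs v)"

definition real_spectral_radius :: "real mat \<Rightarrow> real" where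
  "real_spectral_radius A = spectral_radius (map_mat complex_of_real A)"

definition perron_branch ::
  "'a pair_pre_digraph \<Rightarrow> ('a set \<Rightarrow> real mat) \<Rightarrow> nat \<Rightarrow> 'a list \<Rightarrow> 'a \<Rightarrow> 'a set \<Rightarrow> bool" where
  "perron_branch T W s vs v B \<longleftrightarrow> B \<in> branches T v \<and>
     real_spectral_radius (bottleneck_matrix T W s vs v B) =
       real_spectral_radius (inverse_reduced_laplacian T W s vs v)"

definition mutual_perron ::
  "'a pair_pre_digraph \<Rightarrow> ('a set \<Rightarrow> real mat) \<Rightarrow> nat \<Rightarrow> 'a list \<Rightarrow> 'a \<Rightarrow> 'a \<Rightarrow> bool" where
  "mutual_perron T W s vs u v \<longleftrightarrow> (u, v) \<in> parcs T \<and>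
     (\<exists>B. perron_branch T W s vs u B \<and> v \<in> B) \<and>
     (\<exists>B. perron_branch T W s vs v B \<and> u \<in> B)"

end

theory Submission
  imports Defs
begin

text \<open>
  Write \<open>\<rho>\<^sub>x(D)\<close> for the spectral radius of the bottleneck matrix of the branch \<open>D\<close> at \<open>x\<close>. The
  theorem is a consequence of one inequality, \<open>bottleneck_spectral_radius_mono\<close>: if a branch \<open>D\<close> at
  \<open>x\<close> is contained in a branch \<open>D'\<close> at \<open>u\<close>, then \<open>\<rho>\<^sub>x(D) \<le> \<rho>\<^sub>u(D')\<close>.

  The inequality is best seen electrically. The bottleneck matrices are symmetric and positive
  semidefinite, so their spectral radii are the maxima of their quadratic forms on unit vectors
  (\<open>quad_form_le_spectral_radius\<close>, \<open>spectral_radius_le_quad_form\<close>). The value of the form at a current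
  \<open>f\<close> supported on \<open>D\<close> is \<open>f \<bullet> y\<close>, where the potential \<open>y\<close> vanishes at \<open>x\<close> and satisfies \<open>L y = f\<close>
  everywhere else. A current inside \<open>D\<close> cannot leave \<open>D\<close> except into the ground \<open>x\<close>, so \<open>y\<close> vanishes
  outside \<open>D\<close> (\<open>potential_supported_on_branch\<close>), in particular at \<open>u\<close>. Compare it with the potential
  \<open>z\<close> of the same current grounded at \<open>u\<close>: testing \<open>L z = f\<close> with \<open>y\<close> and with \<open>z\<close> gives
  \<open>0 \<le> (z - y) \<bullet> L (z - y) = f \<bullet> z - f \<bullet> y\<close>.

  Existence of the edge is combinatorial. Among all Perron branches choose a smallest one, say \<open>P x\<close>
  at \<open>x\<close>, and let \<open>y\<close> be the neighbour of \<open>x\<close> in it. If the Perron branch at \<open>y\<close> did not contain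
  \<open>x\<close>, it would be a branch properly contained in \<open>P x\<close>.

  For the location of the other Perron branches let \<open>u\<close> and \<open>v\<close> be adjacent, let the Perron branch
  \<open>B'\<close> at \<open>u\<close> contain \<open>v\<close>, and let \<open>x \<noteq> u\<close> be a vertex outside \<open>B'\<close>. A branch \<open>D\<close> at \<open>x\<close> that
  does not contain \<open>u\<close> lies in the branch \<open>D'\<close> at \<open>u\<close> that contains \<open>x\<close>, and \<open>D' \<noteq> B'\<close>. The
  branch \<open>C\<close> at \<open>x\<close> towards \<open>u\<close> contains \<open>B'\<close>. Hence
  \<open>\<rho>\<^sub>x(D) \<le> \<rho>\<^sub>u(D') < \<rho>\<^sub>u(B') \<le> \<rho>\<^sub>x(C)\<close>, and \<open>D\<close> is not the Perron branch. If \<open>x\<close> lies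
  in \<open>B'\<close>, then it lies outside the Perron branch at \<open>v\<close>, because an edge of a tree is a bridge, and
  the argument applies with \<open>u\<close> and \<open>v\<close> exchanged.

  Two edges with the mutual property coincide: the Perron branches at \<open>u\<close> and at \<open>v\<close> are the two
  sides of the edge \<open>{u, v}\<close>, each must contain an end of the other edge, and \<open>{u, v}\<close> is the only
  edge that joins the two sides.
\<close>

section \<open>Spectral radius and quadratic form of a symmetric matrix\<close>

lemma sym_mat_scalar_prod:
  fixes A :: "real mat"
  assumes "A \<in> carrier_mat n n" "A\<^sup>T = A" "x \<in> carrier_vec n" "y \<in> carrier_vec n"
  shows "(A *\<^sub>v x) \<bullet> y = x \<bullet> (A *\<^sub>v y)"
  using transpose_vec_mult_scalar[OF assms(1,4,3)] assms(2) by simp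

lemma scalar_prod_self_nonneg: "0 \<le> x \<bullet> (x :: real vec)"
  by (simp add: scalar_prod_def sum_nonneg)

lemma scalar_prod_self_eq_0D:
  fixes x :: "real vec"
  assumes x: "x \<in> carrier_vec n" and "x \<bullet> x = 0"
  shows "x = 0\<^sub>v n"
proof (rule eq_vecI)
  fix i assume i: "i < dim_vec (0\<^sub>v n :: real vec)"
  have "(\<Sum>i<n. x $ i * x $ i) = 0" using assms by (simp add: scalar_prod_def atLeast0LessThan)
  then have "\<forall>i\<in>{..<n}. x $ i * x $ i = 0" by (subst (asm) sum_nonneg_eq_0_iff) auto
  then show "x $ i = 0\<^sub>v n $ i" using i by simp
qed (use x in simp)

lemma scalar_prod_Cauchy_Schwarz:
  fixes x y :: "real vec"
  assumes x: "x \<in> carrier_vec n" and y: "y \<in> carrier_vec n"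
  shows "(x \<bullet> y)\<^sup>2 \<le> (x \<bullet> x) * (y \<bullet> y)"
proof (cases "x \<bullet> x = 0")
  case True
  then show ?thesis using scalar_prod_self_eq_0D[OF x True] y by simp
next
  case False
  define d p where "d = x \<bullet> x" and "p = x \<bullet> y"
  have "d > 0" using False scalar_prod_self_nonneg[of x] by (simp add: d_def)
  have "0 \<le> (\<Sum>i<n. (d * y $ i - p * x $ i)\<^sup>2)" by (intro sum_nonneg) auto
  also have "\<dots> = d\<^sup>2 * (\<Sum>i<n. y $ i * y $ i) - 2 * d * p * (\<Sum>i<n. x $ i * y $ i)
      + p\<^sup>2 * (\<Sum>i<n. x $ i * x $ i)"
    by (simp add: power2_eq_square algebra_simps sum.distrib sum_subtractf sum_distrib_left)
  also have "\<dots> = d\<^sup>2 * (y \<bullet> y) - 2 * d * p * p + p\<^sup>2 * d"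
    using x y by (simp add: d_def p_def scalar_prod_def atLeast0LessThan)
  also have "\<dots> = d * (d * (y \<bullet> y) - p\<^sup>2)" by (simp add: power2_eq_square algebra_simps)
  finally show ?thesis using \<open>d > 0\<close> by (simp add: zero_le_mult_iff d_def p_def)
qed

text \<open>
  Cauchy-Schwarz for \<open>x\<close> and \<open>A x\<close>, where \<open>A x \<bullet> A x = x \<bullet> A\<^sup>2 x\<close> by symmetry. This is the
  step that will be iterated.
\<close>

lemma sym_mat_quad_power2_le:
  fixes A :: "real mat"
  assumes A: "A \<in> carrier_mat n n" "A\<^sup>T = A" and x: "x \<in> carrier_vec n"
  shows "(x \<bullet> (A *\<^sub>v x))\<^sup>2 \<le> (x \<bullet> x) * (x \<bullet> ((A * A) *\<^sub>v x))"
proof -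
  have "x \<bullet> ((A * A) *\<^sub>v x) = (A *\<^sub>v x) \<bullet> (A *\<^sub>v x)"
    using sym_mat_scalar_prod[OF A x, of "A *\<^sub>v x"] A x by (simp add: assoc_mult_mat_vec[OF A(1) A(1) x])
  with scalar_prod_Cauchy_Schwarz[OF x, of "A *\<^sub>v x"] show ?thesis using A x by simp
qed

text \<open>
  A crude bound, good enough because only its independence of the power of a matrix is used
  later.
\<close>

lemma norm_bound_quad_form:
  fixes A :: "real mat"
  assumes A: "A \<in> carrier_mat n n" and b: "norm_bound A b" and x: "x \<in> carrier_vec n"
  shows "x \<bullet> (A *\<^sub>v x) \<le> b * (\<Sum>i<n. \<bar>x $ i\<bar>)\<^sup>2"
proof -
  have "x \<bullet> (A *\<^sub>v x) = (\<Sum>i<n. \<Sum>j<n. x $ i * A $$ (i, j) * x $ j)"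
    using A x by (auto simp: scalar_prod_def sum_distrib_left mult.assoc atLeast0LessThan intro!: sum.cong)
  also have "\<dots> \<le> (\<Sum>i<n. \<Sum>j<n. b * (\<bar>x $ i\<bar> * \<bar>x $ j\<bar>))"
  proof (intro sum_mono)
    fix i j assume "i \<in> {..<n}" "j \<in> {..<n}"
    then have "\<bar>A $$ (i, j)\<bar> \<le> b" using b A by (auto simp: norm_bound_def)
    have "x $ i * A $$ (i, j) * x $ j \<le> \<bar>x $ i * A $$ (i, j) * x $ j\<bar>" by simp
    also have "\<dots> = \<bar>A $$ (i, j)\<bar> * (\<bar>x $ i\<bar> * \<bar>x $ j\<bar>)" by (simp add: abs_mult)
    also have "\<dots> \<le> b * (\<bar>x $ i\<bar> * \<bar>x $ j\<bar>)"
      using \<open>\<bar>A $$ (i, j)\<bar> \<le> b\<close> by (intro mult_right_mono) auto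
    finally show "x $ i * A $$ (i, j) * x $ j \<le> b * (\<bar>x $ i\<bar> * \<bar>x $ j\<bar>)" .
  qed
  also have "\<dots> = b * (\<Sum>i<n. \<bar>x $ i\<bar>)\<^sup>2"
    by (simp only: power2_eq_square sum_product) (simp only: sum_distrib_left)
  finally show ?thesis .
qed

lemma pow_mat_add:
  fixes A :: "'a :: semiring_1 mat"
  assumes A: "A \<in> carrier_mat n n"
  shows "A ^\<^sub>m (k + l) = A ^\<^sub>m k * A ^\<^sub>m l"
proof (induction l)
  case 0 then show ?case using A by simp
next
  case (Suc l) then show ?case using A by (simp add: assoc_mult_mat[of _ n n _ n _ n])
qed

lemma transpose_power_mat:
  fixes A :: "real mat"
  assumes A: "A \<in> carrier_mat n n" "A\<^sup>T = A"
  shows "(A ^\<^sub>m k)\<^sup>T = A ^\<^sub>m k"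
proof (induction k)
  case 0 then show ?case by (simp add: transpose_one)
next
  case (Suc k)
  have "(A ^\<^sub>m Suc k)\<^sup>T = A * A ^\<^sub>m k"
    using transpose_mult[of "A ^\<^sub>m k" n n A n] A Suc by simp
  also have "\<dots> = A ^\<^sub>m Suc k" using pow_mat_add[OF A(1), of 1 k] A(1) by simp
  finally show ?case .
qed

text \<open>
  Repeated squaring: a Rayleigh quotient of at least \<open>r\<close> for \<open>A\<close> propagates to at least
  \<open>r ^ 2 ^ k\<close> for \<open>A ^ 2 ^ k\<close> at the same vector.
\<close>

lemma sym_mat_quad_pow2_power_ge:
  fixes A :: "real mat"
  assumes A: "A \<in> carrier_mat n n" "A\<^sup>T = A" and x: "x \<in> carrier_vec n"
    and d: "x \<bullet> x > 0" and r: "r \<ge> 0" "x \<bullet> (A *\<^sub>v x) \<ge> r * (x \<bullet> x)"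
  shows "x \<bullet> ((A ^\<^sub>m (2 ^ k)) *\<^sub>v x) \<ge> r ^ (2 ^ k) * (x \<bullet> x)"
proof (induction k)
  case 0
  then show ?case using A r by simp
next
  case (Suc k)
  let ?B = "A ^\<^sub>m (2 ^ k)" and ?d = "x \<bullet> x"
  have B: "?B \<in> carrier_mat n n" "?B\<^sup>T = ?B" using A transpose_power_mat by auto
  have eq: "A ^\<^sub>m (2 ^ Suc k) = ?B * ?B"
    using pow_mat_add[OF A(1), of "2 ^ k" "2 ^ k"] by (simp add: mult_2)
  have "(r ^ (2 ^ k) * ?d)\<^sup>2 \<le> (x \<bullet> (?B *\<^sub>v x))\<^sup>2"
    using Suc d r by (intro power_mono) auto
  also have "\<dots> \<le> ?d * (x \<bullet> ((?B * ?B) *\<^sub>v x))"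
    by (rule sym_mat_quad_power2_le[OF B x])
  finally have "?d * (r ^ (2 ^ Suc k) * ?d) \<le> ?d * (x \<bullet> ((?B * ?B) *\<^sub>v x))"
    by (simp add: power2_eq_square power_mult_distrib mult_2 power_add mult.commute mult.left_commute)
  then show ?case unfolding eq using d by (simp only: mult_le_cancel_left_pos)
qed
lemma transpose_smult_mat: "(c \<cdot>\<^sub>m A)\<^sup>T = c \<cdot>\<^sub>m A\<^sup>T"
  by (intro eq_matI) auto

lemma real_spectral_radius_nonneg:
  assumes "A \<in> carrier_mat n n" "n > 0"
  shows "0 \<le> real_spectral_radius A"
  using spectral_radius_mem_max(1)[of "map_mat complex_of_real A" n] assms
  by (auto simp: real_spectral_radius_def)

text \<open>
  An eigenvector of \<open>c A\<close> is one of \<open>A\<close>, with the eigenvalue divided by \<open>c\<close>.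
\<close>

lemma real_spectral_radius_smult_le:
  assumes A: "A \<in> carrier_mat n n" "n > 0" and c: "c > 0"
  shows "real_spectral_radius (c \<cdot>\<^sub>m A) \<le> c * real_spectral_radius A"
proof -
  let ?A = "map_mat complex_of_real A" and ?C = "map_mat complex_of_real (c \<cdot>\<^sub>m A)"
  have C: "?C \<in> carrier_mat n n" "?A \<in> carrier_mat n n" using A by auto
  from spectral_radius_mem_max(1)[OF C(1) A(2)] obtain k v
    where k: "real_spectral_radius (c \<cdot>\<^sub>m A) = cmod k" and v: "eigenvector ?C v k"
    by (auto simp: real_spectral_radius_def spectrum_def eigenvalue_def)
  have vn: "v \<in> carrier_vec n" "v \<noteq> 0\<^sub>v n" "?C *\<^sub>v v = k \<cdot>\<^sub>v v"
    using v C A by (auto simp: eigenvector_def)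
  have "?C *\<^sub>v v = complex_of_real c \<cdot>\<^sub>v (?A *\<^sub>v v)"
    using A vn(1) by (intro eq_vecI) (auto simp: scalar_prod_def sum_distrib_left mult.assoc)
  then have "?A *\<^sub>v v = (1 / complex_of_real c) \<cdot>\<^sub>v (k \<cdot>\<^sub>v v)"
    using vn c C by (metis (no_types, lifting) divide_self_if less_irrefl mult_cancel_left2 nonzero_eq_divide_eq of_real_eq_0_iff one_smult_vec smult_smult_assoc times_divide_eq_left)
  then have "eigenvector ?A v (k / complex_of_real c)"
    using vn C A by (simp add: eigenvector_def smult_smult_assoc)
  then have "k / complex_of_real c \<in> spectrum ?A"
    unfolding spectrum_def eigenvalue_def by blast
  then have "cmod (k / complex_of_real c) \<in> cmod ` spectrum ?A" by (rule imageI)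
  from spectral_radius_mem_max(2)[OF C(2) A(2) this]
  show ?thesis using k c by (simp add: real_spectral_radius_def norm_divide field_simps)
qed

text \<open>
  If the Rayleigh quotient at \<open>x\<close> exceeded 1, the forms of the powers \<open>A ^ 2 ^ k\<close> would be
  unbounded at \<open>x\<close>. But the powers of a matrix whose spectral radius is less than 1 are
  bounded, by its Jordan normal form.
\<close>

lemma quad_form_le_of_spectral_radius_less_1:
  fixes A :: "real mat"
  assumes A: "A \<in> carrier_mat n n" "A\<^sup>T = A" and x: "x \<in> carrier_vec n"
    and less: "real_spectral_radius A < 1"
  shows "x \<bullet> (A *\<^sub>v x) \<le> x \<bullet> x"
proof (rule ccontr)
  assume "\<not> ?thesis"
  then have gt: "x \<bullet> (A *\<^sub>v x) > x \<bullet> x" by simp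
  have d: "x \<bullet> x > 0"
  proof (rule ccontr)
    assume "\<not> ?thesis"
    then have "x \<bullet> x = 0" using scalar_prod_self_nonneg[of x] by simp
    with scalar_prod_Cauchy_Schwarz[OF x, of "A *\<^sub>v x"] A x gt show False by simp
  qed
  define r where "r = (x \<bullet> (A *\<^sub>v x)) / (x \<bullet> x)"
  have r: "r > 1" "x \<bullet> (A *\<^sub>v x) \<ge> r * (x \<bullet> x)" using gt d by (auto simp: r_def)
  let ?A = "map_mat complex_of_real A"
  obtain b where b: "\<And>k. norm_bound (?A ^\<^sub>m k) b"
    using spectral_radius_jnf_norm_bound_less_1_upper_triangular[of ?A n] A(1) less
    by (auto simp: real_spectral_radius_def)
  have bA: "norm_bound (A ^\<^sub>m k) b" for k
    using b[of k] of_real_hom.mat_hom_pow[OF A(1), of k, where 'a = complex, symmetric] A(1)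
    by (auto simp: norm_bound_def)
  let ?K = "b * (\<Sum>i<n. \<bar>x $ i\<bar>)\<^sup>2"
  have bound: "r ^ (2 ^ k) * (x \<bullet> x) \<le> ?K" for k
    using sym_mat_quad_pow2_power_ge[OF A x d _ r(2), of k] r(1)
      norm_bound_quad_form[OF _ bA x, of "2 ^ k"] A(1) by force
  obtain k where k: "r ^ k > ?K / (x \<bullet> x)" using real_arch_pow[OF r(1)] by blast
  have "r ^ k \<le> r ^ (2 ^ k)" using r(1) by (intro power_increasing) (auto intro: less_imp_le)
  with k have "r ^ (2 ^ k) > ?K / (x \<bullet> x)" by linarith
  with bound[of k] d show False by (simp add: field_simps)
qed

text \<open>
  The upper half of the Rayleigh principle. Apply the preceding bound to \<open>A / c\<close> for \<open>c\<close>
  greater than the spectral radius and let \<open>c\<close> tend to it.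
\<close>

lemma quad_form_le_spectral_radius:
  fixes A :: "real mat"
  assumes A: "A \<in> carrier_mat n n" "A\<^sup>T = A" and x: "x \<in> carrier_vec n"
  shows "x \<bullet> (A *\<^sub>v x) \<le> real_spectral_radius A * (x \<bullet> x)"
proof (cases "n = 0")
  case True
  then show ?thesis using A x by (simp add: scalar_prod_def)
next
  case False
  let ?r = "real_spectral_radius A"
  have r: "?r \<ge> 0" using real_spectral_radius_nonneg A False by auto
  have *: "x \<bullet> (A *\<^sub>v x) \<le> c * (x \<bullet> x)" if c: "c > ?r" for c
  proof -
    have c0: "c > 0" using c r by simp
    have "real_spectral_radius ((1 / c) \<cdot>\<^sub>m A) \<le> 1 / c * ?r"
      using real_spectral_radius_smult_le[of A n "1 / c"] A False c0 by simp
    also have "\<dots> < 1" using c c0 by simp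
    finally have "x \<bullet> (((1 / c) \<cdot>\<^sub>m A) *\<^sub>v x) \<le> x \<bullet> x"
      using A x by (intro quad_form_le_of_spectral_radius_less_1[of _ n]) (auto simp: transpose_smult_mat)
    also have "((1 / c) \<cdot>\<^sub>m A) *\<^sub>v x = (1 / c) \<cdot>\<^sub>v (A *\<^sub>v x)"
      using A x by (intro eq_vecI) (auto simp: scalar_prod_def sum_divide_distrib)
    finally show ?thesis using c0 A x by (simp add: field_simps)
  qed
  show ?thesis
  proof (rule field_le_epsilon)
    fix e :: real assume e: "e > 0"
    have d: "x \<bullet> x \<ge> 0" by (rule scalar_prod_self_nonneg)
    \<comment> \<open>The summand 1 keeps the denominator positive when \<open>x = 0\<close>.\<close>
    have "x \<bullet> (A *\<^sub>v x) \<le> (?r + e / (x \<bullet> x + 1)) * (x \<bullet> x)" using e d by (intro *) auto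
    also have "\<dots> = ?r * (x \<bullet> x) + e * ((x \<bullet> x) / (x \<bullet> x + 1))" by (simp add: algebra_simps)
    also have "\<dots> \<le> ?r * (x \<bullet> x) + e * 1" using e d by (intro add_left_mono mult_left_mono) auto
    finally show "x \<bullet> (A *\<^sub>v x) \<le> ?r * (x \<bullet> x) + e" by simp
  qed
qed

text \<open>
  The lower half of the Rayleigh principle. The spectral radius is attained at a complex
  eigenvalue \<open>k\<close> with an eigenvector \<open>a + \<i> b\<close>. By symmetry \<open>k\<close> is real, and
  \<open>k (a \<bullet> a + b \<bullet> b)\<close> is the sum of the quadratic forms at \<open>a\<close> and \<open>b\<close>, so both bounds on the
  form pass to \<open>k\<close>. Positive semidefiniteness matters: it excludes that \<open>\<bar>k\<bar>\<close> comes from a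
  negative eigenvalue.
\<close>

lemma spectral_radius_le_quad_form:
  fixes A :: "real mat"
  assumes A: "A \<in> carrier_mat n n" "A\<^sup>T = A" and n: "n > 0"
    and nonneg: "\<And>x. x \<in> carrier_vec n \<Longrightarrow> 0 \<le> x \<bullet> (A *\<^sub>v x)"
    and le: "\<And>x. x \<in> carrier_vec n \<Longrightarrow> x \<bullet> (A *\<^sub>v x) \<le> c * (x \<bullet> x)"
  shows "real_spectral_radius A \<le> c"
proof -
  let ?A = "map_mat complex_of_real A"
  have C: "?A \<in> carrier_mat n n" using A by simp
  from spectral_radius_mem_max(1)[OF C n] obtain k v
    where k: "real_spectral_radius A = cmod k" and v: "eigenvector ?A v k"
    by (auto simp: real_spectral_radius_def spectrum_def eigenvalue_def)
  have vn: "v \<in> carrier_vec n" "v \<noteq> 0\<^sub>v n" "?A *\<^sub>v v = k \<cdot>\<^sub>v v"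
    using v C A by (auto simp: eigenvector_def)
  define a b where "a = map_vec Re v" and "b = map_vec Im v"
  have ab: "a \<in> carrier_vec n" "b \<in> carrier_vec n" using vn by (auto simp: a_def b_def)
  have row: "(\<Sum>j<n. A $$ (i, j) * a $ j) = Re (k * v $ i)"
    "(\<Sum>j<n. A $$ (i, j) * b $ j) = Im (k * v $ i)" if i: "i < n" for i
  proof -
    have "(\<Sum>j<n. complex_of_real (A $$ (i, j)) * v $ j) = k * v $ i"
      using arg_cong[OF vn(3), of "\<lambda>w. w $ i"] i vn(1) A(1)
      by (simp add: scalar_prod_def atLeast0LessThan)
    from arg_cong[OF this, of Re] arg_cong[OF this, of Im]
    show "(\<Sum>j<n. A $$ (i, j) * a $ j) = Re (k * v $ i)"
      "(\<Sum>j<n. A $$ (i, j) * b $ j) = Im (k * v $ i)"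
      using vn(1) by (auto simp: a_def b_def)
  qed
  have Aa: "A *\<^sub>v a = Re k \<cdot>\<^sub>v a - Im k \<cdot>\<^sub>v b" "A *\<^sub>v b = Re k \<cdot>\<^sub>v b + Im k \<cdot>\<^sub>v a"
    using A vn(1) ab row by (auto simp: scalar_prod_def atLeast0LessThan a_def b_def intro!: eq_vecI)
  let ?d = "a \<bullet> a + b \<bullet> b"
  have comm: "b \<bullet> a = a \<bullet> b" using ab by (rule comm_scalar_prod[rotated])
  have qa: "a \<bullet> (A *\<^sub>v a) = Re k * (a \<bullet> a) - Im k * (a \<bullet> b)"
    "b \<bullet> (A *\<^sub>v b) = Re k * (b \<bullet> b) + Im k * (a \<bullet> b)"
    "a \<bullet> (A *\<^sub>v b) = Re k * (a \<bullet> b) + Im k * (a \<bullet> a)"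
    "b \<bullet> (A *\<^sub>v a) = Re k * (a \<bullet> b) - Im k * (b \<bullet> b)"
    unfolding Aa using ab comm
    by (simp_all add: scalar_prod_minus_distrib[of _ n] scalar_prod_add_distrib[of _ n])
  \<comment> \<open>Comparing the two mixed products shows that the eigenvalue is real.\<close>
  have "a \<bullet> (A *\<^sub>v b) = b \<bullet> (A *\<^sub>v a)"
    using sym_mat_scalar_prod[OF A ab] comm_scalar_prod[of "A *\<^sub>v a" n b] A ab by simp
  then have "Im k * ?d = 0" using qa by (simp add: algebra_simps)
  moreover have d: "?d > 0"
  proof (rule ccontr)
    assume "\<not> ?thesis"
    then have "a \<bullet> a = 0" "b \<bullet> b = 0"
      using scalar_prod_self_nonneg[of a] scalar_prod_self_nonneg[of b] by auto
    then have "a = 0\<^sub>v n" "b = 0\<^sub>v n" using ab scalar_prod_self_eq_0D by auto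
    then have "a $ i = 0 \<and> b $ i = 0" if "i < n" for i using that by simp
    then have "v = 0\<^sub>v n" using vn(1) by (auto simp: a_def b_def complex_eq_iff intro!: eq_vecI)
    with vn(2) show False by simp
  qed
  ultimately have Im: "Im k = 0" by simp
  have sum: "Re k * ?d = a \<bullet> (A *\<^sub>v a) + b \<bullet> (A *\<^sub>v b)" using qa by (simp add: algebra_simps)
  then have "0 \<le> Re k * ?d" using nonneg[OF ab(1)] nonneg[OF ab(2)] by simp
  then have "0 \<le> Re k" using d by (simp add: zero_le_mult_iff)
  moreover have "Re k * ?d \<le> c * ?d" using sum le[OF ab(1)] le[OF ab(2)] by (simp add: algebra_simps)
  then have "Re k \<le> c" using d by simp
  ultimately show ?thesis using k Im by (simp add: cmod_eq_Re)
qed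

section \<open>Principal submatrices as restricted quadratic forms\<close>

text \<open>
  The entries in \<open>I\<close> are taken in increasing order, as in \<^const>\<open>submatrix\<close>.
\<close>

definition restrict_vec :: "nat set \<Rightarrow> real vec \<Rightarrow> real vec" where
  "restrict_vec I x = vec (card I) (\<lambda>k. x $ pick I k)"

text \<open>
  The number of elements of \<open>I\<close> below \<open>i\<close> is the inverse of \<^term>\<open>pick I\<close>.
\<close>

definition extend_vec :: "nat \<Rightarrow> nat set \<Rightarrow> real vec \<Rightarrow> real vec" where
  "extend_vec N I y = vec N (\<lambda>i. if i \<in> I then y $ card {a \<in> I. a < i} else 0)"

definition supported_on :: "nat set \<Rightarrow> real vec \<Rightarrow> bool" where
  "supported_on I x \<longleftrightarrow> (\<forall>i < dim_vec x. i \<notin> I \<longrightarrow> x $ i = 0)"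

lemma supported_onD: "supported_on I x \<Longrightarrow> x \<in> carrier_vec N \<Longrightarrow> i < N \<Longrightarrow> i \<notin> I \<Longrightarrow> x $ i = 0"
  by (simp add: supported_on_def)

lemma supported_on_mono: "supported_on I x \<Longrightarrow> I \<subseteq> J \<Longrightarrow> supported_on J x"
  by (auto simp: supported_on_def)

lemma bij_betw_pick:
  assumes "finite I"
  shows "bij_betw (pick I) {..<card I} I"
proof (rule bij_betw_imageI)
  show "inj_on (pick I) {..<card I}"
  proof (rule inj_onI)
    fix k l assume kl: "k \<in> {..<card I}" "l \<in> {..<card I}" "pick I k = pick I l"
    have "k = card {a \<in> I. a < pick I k}" using kl(1) card_pick[of k I] by (metis lessThan_iff)
    also have "\<dots> = card {a \<in> I. a < pick I l}" by (simp only: kl(3))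
    also have "\<dots> = l" using kl(2) card_pick[of l I] by (metis lessThan_iff)
    finally show "k = l" .
  qed
  show "pick I ` {..<card I} = I"
  proof (rule subset_antisym)
    show "pick I ` {..<card I} \<subseteq> I"
    proof (rule image_subsetI)
      fix k assume "k \<in> {..<card I}"
      then have "k < card I \<or> infinite I" by simp
      then show "pick I k \<in> I" by (rule pick_in_set)
    qed
    show "I \<subseteq> pick I ` {..<card I}"
    proof
      fix i assume i: "i \<in> I"
      then have "{a \<in> I. a < i} \<subset> I" by auto
      then have "card {a \<in> I. a < i} < card I" using assms by (rule psubset_card_mono[rotated])
      then show "i \<in> pick I ` {..<card I}"
        using pick_card_in_set[OF i] by (intro image_eqI[of _ _ "card {a \<in> I. a < i}"]) simp_all
    qed
  qed
qed

lemma pick_obtain: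
  assumes "finite I" "i \<in> I"
  obtains k where "k < card I" "pick I k = i"
proof -
  have "i \<in> pick I ` {..<card I}" using bij_betw_imp_surj_on[OF bij_betw_pick[OF assms(1)]] assms(2) by simp
  then show ?thesis using that by auto
qed

lemma sum_pick: "finite I \<Longrightarrow> (\<Sum>k<card I. g (pick I k)) = sum g I"
  by (rule sum.reindex_bij_betw[OF bij_betw_pick])

lemma restrict_vec_carrier: "restrict_vec I x \<in> carrier_vec (card I)"
  by (simp add: restrict_vec_def)

lemma extend_vec_carrier: "extend_vec N I y \<in> carrier_vec N"
  by (simp add: extend_vec_def)

lemma supported_on_extend_vec: "supported_on I (extend_vec N I y)"
  by (simp add: supported_on_def extend_vec_def)

lemma restrict_extend_vec:
  assumes "I \<subseteq> {..<N}" "y \<in> carrier_vec (card I)"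
  shows "restrict_vec I (extend_vec N I y) = y"
proof (rule eq_vecI)
  fix k assume "k < dim_vec y"
  then have k: "k < card I" using assms by simp
  then have "pick I k \<in> I" by (simp add: pick_in_set)
  then show "restrict_vec I (extend_vec N I y) $ k = y $ k"
    using k assms(1) card_pick[of k I] by (auto simp: restrict_vec_def extend_vec_def)
qed (use assms in \<open>simp add: restrict_vec_def\<close>)

lemma scalar_prod_supported:
  assumes x: "x \<in> carrier_vec N" "supported_on I x" and y: "y \<in> carrier_vec N" and I: "I \<subseteq> {..<N}"
  shows "x \<bullet> y = (\<Sum>i\<in>I. x $ i * y $ i)"
proof -
  have "x \<bullet> y = (\<Sum>i<N. x $ i * y $ i)" using y by (simp add: scalar_prod_def atLeast0LessThan)
  also have "\<dots> = (\<Sum>i\<in>I. x $ i * y $ i)"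
    using I supported_onD[OF x(2,1)] by (intro sum.mono_neutral_right) auto
  finally show ?thesis .
qed

lemma restrict_vec_scalar_prod:
  assumes x: "x \<in> carrier_vec N" "supported_on I x" and y: "y \<in> carrier_vec N" and I: "I \<subseteq> {..<N}"
  shows "restrict_vec I x \<bullet> restrict_vec I y = x \<bullet> y"
proof -
  have "restrict_vec I x \<bullet> restrict_vec I y = (\<Sum>k<card I. x $ pick I k * y $ pick I k)"
    by (simp add: restrict_vec_def scalar_prod_def atLeast0LessThan)
  also have "\<dots> = (\<Sum>i\<in>I. x $ i * y $ i)"
    using sum_pick[of I "\<lambda>i. x $ i * y $ i"] I finite_subset by blast
  finally show ?thesis using scalar_prod_supported[OF assms] by simp
qed

lemma
  assumes A: "A \<in> carrier_mat N N" and I: "I \<subseteq> {..<N}"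
  shows submatrix_carrier: "submatrix A I I \<in> carrier_mat (card I) (card I)"
    and submatrix_nth: "\<And>i j. i < card I \<Longrightarrow> j < card I \<Longrightarrow> submatrix A I I $$ (i, j) = A $$ (pick I i, pick I j)"
proof -
  have "{i. i < N \<and> i \<in> I} = I" using I by auto
  then show "submatrix A I I \<in> carrier_mat (card I) (card I)"
    "\<And>i j. i < card I \<Longrightarrow> j < card I \<Longrightarrow> submatrix A I I $$ (i, j) = A $$ (pick I i, pick I j)"
    using A by (auto simp: submatrix_def)
qed

lemma pick_less: "I \<subseteq> {..<N} \<Longrightarrow> k < card I \<Longrightarrow> pick I k < N"
  using pick_in_set[of k I] by auto

lemma transpose_submatrix:
  assumes A: "A \<in> carrier_mat N N" "A\<^sup>T = A" and I: "I \<subseteq> {..<N}"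
  shows "(submatrix A I I)\<^sup>T = submatrix A I I"
proof -
  have "A $$ (j, i) = A $$ (i, j)" if "i < N" "j < N" for i j
    using A that index_transpose_mat(1)[of i A j] by simp
  then show ?thesis
    using submatrix_carrier[OF A(1) I] submatrix_nth[OF A(1) I] pick_less[OF I]
    by (intro eq_matI) auto
qed

text \<open>
  For a vector supported on \<open>I\<close>, deleting the other rows and columns commutes with the
  matrix-vector product. This and the next lemmas make it possible to work with vectors of the
  full dimension throughout.
\<close>

lemma submatrix_mult_restrict_vec:
  assumes A: "A \<in> carrier_mat N N" and I: "I \<subseteq> {..<N}" and x: "x \<in> carrier_vec N" "supported_on I x"
  shows "submatrix A I I *\<^sub>v restrict_vec I x = restrict_vec I (A *\<^sub>v x)"
proof (rule eq_vecI)
  fix k assume "k < dim_vec (restrict_vec I (A *\<^sub>v x))"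
  then have k: "k < card I" by (simp add: restrict_vec_def)
  have "(submatrix A I I *\<^sub>v restrict_vec I x) $ k = (\<Sum>l<card I. A $$ (pick I k, pick I l) * x $ pick I l)"
    using k submatrix_carrier[OF A I] submatrix_nth[OF A I]
    by (simp add: scalar_prod_def restrict_vec_def atLeast0LessThan)
  also have "\<dots> = (\<Sum>i\<in>I. A $$ (pick I k, i) * x $ i)"
    using sum_pick[of I "\<lambda>i. A $$ (pick I k, i) * x $ i"] I finite_subset by blast
  also have "\<dots> = (\<Sum>i<N. A $$ (pick I k, i) * x $ i)"
    using I supported_onD[OF x(2,1)] by (intro sum.mono_neutral_left) auto
  also have "\<dots> = restrict_vec I (A *\<^sub>v x) $ k"
    using k A x pick_less[OF I k] by (simp add: restrict_vec_def scalar_prod_def atLeast0LessThan)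
  finally show "(submatrix A I I *\<^sub>v restrict_vec I x) $ k = restrict_vec I (A *\<^sub>v x) $ k" .
qed (use submatrix_carrier[OF A I] in \<open>simp add: restrict_vec_def\<close>)

lemma submatrix_quad_form:
  assumes A: "A \<in> carrier_mat N N" and I: "I \<subseteq> {..<N}" and x: "x \<in> carrier_vec N" "supported_on I x"
  shows "restrict_vec I x \<bullet> (submatrix A I I *\<^sub>v restrict_vec I x) = x \<bullet> (A *\<^sub>v x)"
  using submatrix_mult_restrict_vec[OF A I x] restrict_vec_scalar_prod[OF x _ I, of "A *\<^sub>v x"] A x
  by simp

lemma submatrix_quad_form_le_iff:
  assumes A: "A \<in> carrier_mat N N" and I: "I \<subseteq> {..<N}"
  shows "(\<forall>y \<in> carrier_vec (card I). y \<bullet> (submatrix A I I *\<^sub>v y) \<le> c * (y \<bullet> y)) \<longleftrightarrow>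
    (\<forall>x \<in> carrier_vec N. supported_on I x \<longrightarrow> x \<bullet> (A *\<^sub>v x) \<le> c * (x \<bullet> x))"
  (is "?L \<longleftrightarrow> ?R")
proof
  assume ?L
  then show ?R
    using submatrix_quad_form[OF A I] restrict_vec_scalar_prod[OF _ _ _ I] restrict_vec_carrier
    by (metis (no_types))
next
  assume R: ?R
  show ?L
  proof
    fix y :: "real vec" assume y: "y \<in> carrier_vec (card I)"
    let ?x = "extend_vec N I y"
    have x: "?x \<in> carrier_vec N" "supported_on I ?x"
      by (rule extend_vec_carrier supported_on_extend_vec)+
    with R have "?x \<bullet> (A *\<^sub>v ?x) \<le> c * (?x \<bullet> ?x)" by blast
    with submatrix_quad_form[OF A I x] restrict_vec_scalar_prod[OF x x(1) I] restrict_extend_vec[OF I y]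
    show "y \<bullet> (submatrix A I I *\<^sub>v y) \<le> c * (y \<bullet> y)" by simp
  qed
qed

definition pos_semidef_mat :: "nat \<Rightarrow> real mat \<Rightarrow> bool" where
  "pos_semidef_mat n A \<longleftrightarrow> A \<in> carrier_mat n n \<and> A\<^sup>T = A \<and> (\<forall>x \<in> carrier_vec n. 0 \<le> x \<bullet> (A *\<^sub>v x))"

lemma pos_semidef_submatrix:
  assumes A: "pos_semidef_mat N A" and I: "I \<subseteq> {..<N}"
  shows "pos_semidef_mat (card I) (submatrix A I I)"
proof -
  have A': "A \<in> carrier_mat N N" "A\<^sup>T = A" using A by (auto simp: pos_semidef_mat_def)
  have "0 \<le> y \<bullet> (submatrix A I I *\<^sub>v y)" if y: "y \<in> carrier_vec (card I)" for y
  proof -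
    let ?x = "extend_vec N I y"
    have x: "?x \<in> carrier_vec N" "supported_on I ?x"
      by (rule extend_vec_carrier supported_on_extend_vec)+
    have "0 \<le> ?x \<bullet> (A *\<^sub>v ?x)" using A x by (auto simp: pos_semidef_mat_def)
    with submatrix_quad_form[OF A'(1) I x] restrict_extend_vec[OF I y]
    show ?thesis by simp
  qed
  then show ?thesis
    using submatrix_carrier[OF A'(1) I] transpose_submatrix[OF A' I] by (auto simp: pos_semidef_mat_def)
qed

text \<open>
  The form in which spectral radii enter the rest of the proof: as the best constant in an
  inequality between quadratic forms on the vectors that are supported on a fixed set of
  indices.
\<close>

lemma spectral_radius_submatrix_le_iff:
  assumes A: "pos_semidef_mat N A" and I: "I \<subseteq> {..<N}" "I \<noteq> {}"
  shows "real_spectral_radius (submatrix A I I) \<le> c \<longleftrightarrow>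
    (\<forall>x \<in> carrier_vec N. supported_on I x \<longrightarrow> x \<bullet> (A *\<^sub>v x) \<le> c * (x \<bullet> x))"
proof -
  have A': "A \<in> carrier_mat N N" using A by (auto simp: pos_semidef_mat_def)
  have "finite I" using I finite_subset by blast
  then have "card I > 0" using I(2) by (simp add: card_gt_0_iff)
  have S: "submatrix A I I \<in> carrier_mat (card I) (card I)" "(submatrix A I I)\<^sup>T = submatrix A I I"
    "\<And>y. y \<in> carrier_vec (card I) \<Longrightarrow> 0 \<le> y \<bullet> (submatrix A I I *\<^sub>v y)"
    using pos_semidef_submatrix[OF A I(1)] by (auto simp: pos_semidef_mat_def)
  have "real_spectral_radius (submatrix A I I) \<le> c \<longleftrightarrow>
    (\<forall>y \<in> carrier_vec (card I). y \<bullet> (submatrix A I I *\<^sub>v y) \<le> c * (y \<bullet> y))" (is "?L \<longleftrightarrow> ?R")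
  proof
    assume L: ?L
    show ?R
    proof
      fix y :: "real vec" assume y: "y \<in> carrier_vec (card I)"
      have "y \<bullet> (submatrix A I I *\<^sub>v y) \<le> real_spectral_radius (submatrix A I I) * (y \<bullet> y)"
        by (rule quad_form_le_spectral_radius[OF S(1,2) y])
      also have "\<dots> \<le> c * (y \<bullet> y)" using L scalar_prod_self_nonneg by (intro mult_right_mono) auto
      finally show "y \<bullet> (submatrix A I I *\<^sub>v y) \<le> c * (y \<bullet> y)" .
    qed
  qed (use spectral_radius_le_quad_form[OF S(1,2) \<open>card I > 0\<close> S(3)] in blast)
  then show ?thesis using submatrix_quad_form_le_iff[OF A' I(1)] by simp
qed

lemma spectral_radius_submatrix_le:
  assumes A: "pos_semidef_mat N A" and I: "I \<subseteq> {..<N}" "I \<noteq> {}"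
  shows "real_spectral_radius (submatrix A I I) \<le> real_spectral_radius A"
  using A quad_form_le_spectral_radius[of A N]
  by (subst spectral_radius_submatrix_le_iff[OF A I]) (auto simp: pos_semidef_mat_def)

section \<open>Branches of a tree\<close>

locale finite_tree =
  fixes T :: "'a pair_pre_digraph"
  assumes tree: "tree_graph T"
begin

sublocale pair_graph T
  using tree by (simp add: tree_graph_def)

lemma arc_sym: "(a, b) \<in> parcs T \<Longrightarrow> (b, a) \<in> parcs T"
  by (rule arcs_symmetric)

lemma arc_neq: "(a, b) \<in> parcs T \<Longrightarrow> a \<noteq> b"
  by (rule no_loops')

lemma connected: "a \<in> pverts T \<Longrightarrow> b \<in> pverts T \<Longrightarrow> (a, b) \<in> (parcs T)\<^sup>*"
proof -
  assume ab: "a \<in> pverts T" "b \<in> pverts T"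
  have "strongly_connected (with_proj T)"
    using tree symmetric_connected_imp_strongly_connected[OF sym_arcs] by (simp add: tree_graph_def)
  then have "a \<rightarrow>\<^sup>*\<^bsub>with_proj T\<^esub> b" using ab by (auto simp: strongly_connected_def)
  then show ?thesis by (auto dest: reachable_rtranclI)
qed

definition arcs_avoiding :: "'a \<Rightarrow> ('a \<times> 'a) set" where
  "arcs_avoiding x = {(a, b) \<in> parcs T. a \<noteq> x \<and> b \<noteq> x}"

lemma sym_arcs_avoiding: "sym (arcs_avoiding x)"
  by (auto simp: sym_def arcs_avoiding_def arc_sym)

lemma arcs_avoiding_rtrancl_sym: "(a, b) \<in> (arcs_avoiding x)\<^sup>* \<Longrightarrow> (b, a) \<in> (arcs_avoiding x)\<^sup>*"
  using sym_rtrancl[OF sym_arcs_avoiding] by (rule symD)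

lemma reachable_del_vert_iff:
  "a \<rightarrow>\<^sup>*\<^bsub>del_vert x\<^esub> b \<longleftrightarrow> a \<in> pverts T - {x} \<and> (a, b) \<in> (arcs_avoiding x)\<^sup>*"
proof -
  have ends: "arcs_ends (del_vert x) = arcs_avoiding x"
    by (auto simp: arcs_ends_def arc_to_ends_def del_vert_def arcs_avoiding_def)
  have verts: "verts (del_vert x) = pverts T - {x}" by (simp add: del_vert_def)
  show ?thesis
  proof
    assume "a \<rightarrow>\<^sup>*\<^bsub>del_vert x\<^esub> b"
    then show "a \<in> pverts T - {x} \<and> (a, b) \<in> (arcs_avoiding x)\<^sup>*"
      unfolding reachable_def ends verts
      using rtrancl_on_rtranclI in_rtrancl_on_in_F(1) by metis
  next
    assume a: "a \<in> pverts T - {x} \<and> (a, b) \<in> (arcs_avoiding x)\<^sup>*"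
    then have "(a, b) \<in> (arcs_avoiding x)\<^sup>*" by simp
    then show "a \<rightarrow>\<^sup>*\<^bsub>del_vert x\<^esub> b"
      unfolding reachable_def ends verts
    proof induction
      case base show ?case using a by simp
    next
      case (step b c)
      then have "c \<in> pverts T - {x}" by (auto simp: arcs_avoiding_def dest: in_arcsD2)
      with step show ?case by (meson rtrancl_on_into_rtrancl_on)
    qed
  qed
qed

text \<open>
  Branches as reachability classes. The arcs come in opposite pairs, so the strongly connected
  components of the graph without \<open>x\<close> are the classes of an equivalence relation.
\<close>

lemma branch_iff: "D \<in> branches T x \<longleftrightarrow> (\<exists>d \<in> pverts T - {x}. D = (arcs_avoiding x)\<^sup>* `` {d})"
proof
  assume "D \<in> branches T x"
  then have D: "D \<noteq> {}" "\<And>a b. a \<in> D \<Longrightarrow> b \<in> D \<Longrightarrow> a \<rightarrow>\<^sup>*\<^bsub>del_vert x\<^esub> b"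
    "\<And>a b. a \<in> D \<Longrightarrow> b \<notin> D \<Longrightarrow> \<not> a \<rightarrow>\<^sup>*\<^bsub>del_vert x\<^esub> b \<or> \<not> b \<rightarrow>\<^sup>*\<^bsub>del_vert x\<^esub> a"
    by (auto simp: branches_def pre_digraph.sccs_verts_def)
  then obtain d where d: "d \<in> D" by blast
  have "d \<in> pverts T - {x}" using D(2)[OF d d] by (simp add: reachable_del_vert_iff)
  moreover have "D = (arcs_avoiding x)\<^sup>* `` {d}"
  proof (intro subset_antisym subsetI)
    fix e assume "e \<in> D"
    with D(2)[OF d this] show "e \<in> (arcs_avoiding x)\<^sup>* `` {d}" by (simp add: reachable_del_vert_iff)
  next
    fix e assume "e \<in> (arcs_avoiding x)\<^sup>* `` {d}"
    then have e: "(d, e) \<in> (arcs_avoiding x)\<^sup>*" by simp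
    then have "e \<in> pverts T - {x}" using \<open>d \<in> pverts T - {x}\<close>
      by (induction) (auto simp: arcs_avoiding_def dest: in_arcsD2)
    with e D(3)[OF d, of e] \<open>d \<in> pverts T - {x}\<close> arcs_avoiding_rtrancl_sym[OF e] show "e \<in> D"
      by (auto simp: reachable_del_vert_iff)
  qed
  ultimately show "\<exists>d \<in> pverts T - {x}. D = (arcs_avoiding x)\<^sup>* `` {d}" by blast
next
  assume "\<exists>d \<in> pverts T - {x}. D = (arcs_avoiding x)\<^sup>* `` {d}"
  then obtain d where d: "d \<in> pverts T - {x}" "D = (arcs_avoiding x)\<^sup>* `` {d}" by blast
  have in_V: "e \<in> pverts T - {x}" if "(d, e) \<in> (arcs_avoiding x)\<^sup>*" for e
    using that d(1) by (induction) (auto simp: arcs_avoiding_def dest: in_arcsD2)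
  show "D \<in> branches T x"
    unfolding branches_def pre_digraph.sccs_verts_def mem_Collect_eq reachable_del_vert_iff d(2)
  proof (intro conjI ballI allI impI)
    show "(arcs_avoiding x)\<^sup>* `` {d} \<noteq> {}" by blast
  next
    fix a assume "a \<in> (arcs_avoiding x)\<^sup>* `` {d}"
    then show "a \<in> pverts T - {x}" using in_V by blast
  next
    fix a b assume "a \<in> (arcs_avoiding x)\<^sup>* `` {d}" "b \<in> (arcs_avoiding x)\<^sup>* `` {d}"
    then show "(a, b) \<in> (arcs_avoiding x)\<^sup>*"
      using arcs_avoiding_rtrancl_sym[of d a] rtrancl_trans[of a d _ b] by simp
  next
    fix a b assume "a \<in> (arcs_avoiding x)\<^sup>* `` {d}" "b \<notin> (arcs_avoiding x)\<^sup>* `` {d}"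
    then show "\<not> (a \<in> pverts T - {x} \<and> (a, b) \<in> (arcs_avoiding x)\<^sup>*) \<or>
        \<not> (b \<in> pverts T - {x} \<and> (b, a) \<in> (arcs_avoiding x)\<^sup>*)"
      using rtrancl_trans[of d a _ b] by auto
  qed
qed

lemma branch_subset: "D \<in> branches T x \<Longrightarrow> D \<subseteq> pverts T - {x}"
proof -
  assume "D \<in> branches T x"
  then obtain d where d: "d \<in> pverts T - {x}" "D = (arcs_avoiding x)\<^sup>* `` {d}"
    by (auto simp: branch_iff)
  have "e \<in> pverts T - {x}" if "(d, e) \<in> (arcs_avoiding x)\<^sup>*" for e
    using that d(1) by (induction) (auto simp: arcs_avoiding_def dest: in_arcsD2)
  then show ?thesis using d by auto
qed

lemma branch_nonempty: "D \<in> branches T x \<Longrightarrow> D \<noteq> {}"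
  by (auto simp: branch_iff)

lemma branch_eq_reachable:
  assumes D: "D \<in> branches T x" and a: "a \<in> D"
  shows "D = (arcs_avoiding x)\<^sup>* `` {a}"
proof -
  from D obtain d where d: "D = (arcs_avoiding x)\<^sup>* `` {d}" by (auto simp: branch_iff)
  with a have da: "(d, a) \<in> (arcs_avoiding x)\<^sup>*" by simp
  show ?thesis
    unfolding d using rtrancl_trans[OF da] rtrancl_trans[OF arcs_avoiding_rtrancl_sym[OF da]]
    by auto
qed

lemma branch_unique: "D \<in> branches T x \<Longrightarrow> D' \<in> branches T x \<Longrightarrow> a \<in> D \<Longrightarrow> a \<in> D' \<Longrightarrow> D = D'"
  using branch_eq_reachable[of D x a] branch_eq_reachable[of D' x a] by simp

lemma branch_exists:
  assumes "a \<in> pverts T" "a \<noteq> x"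
  shows "\<exists>D \<in> branches T x. a \<in> D"
proof (rule bexI)
  show "a \<in> (arcs_avoiding x)\<^sup>* `` {a}" by simp
  show "(arcs_avoiding x)\<^sup>* `` {a} \<in> branches T x" using assms by (auto simp: branch_iff)
qed

lemma branch_closed:
  assumes "D \<in> branches T x" "a \<in> D" "(a, b) \<in> parcs T" "b \<noteq> x"
  shows "b \<in> D"
proof -
  have "(a, b) \<in> arcs_avoiding x" using branch_subset[OF assms(1)] assms by (auto simp: arcs_avoiding_def)
  then show ?thesis using branch_eq_reachable[OF assms(1,2)] by auto
qed

text \<open>
  Walks can be kept inside the branch, so they avoid any given vertex outside of it.
\<close>

lemma branch_connected:
  assumes D: "D \<in> branches T x" and ab: "a \<in> D" "b \<in> D"
  shows "(a, b) \<in> (parcs T \<inter> D \<times> D)\<^sup>*"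
proof -
  have "(a, b) \<in> (arcs_avoiding x)\<^sup>*" using branch_eq_reachable[OF D ab(1)] ab by auto
  then have "b \<in> D \<and> (a, b) \<in> (parcs T \<inter> D \<times> D)\<^sup>*"
  proof induction
    case base then show ?case using ab by simp
  next
    case (step c d)
    then have "d \<in> D" using branch_closed[OF D, of c d] by (auto simp: arcs_avoiding_def)
    with step show ?case by (auto simp: arcs_avoiding_def intro: rtrancl_into_rtrancl)
  qed
  then show ?thesis by simp
qed

text \<open>Otherwise, no walk from the branch could reach \<open>x\<close>.\<close>

lemma branch_has_neighbour:
  assumes D: "D \<in> branches T x" and x: "x \<in> pverts T"
  shows "\<exists>z \<in> D. (x, z) \<in> parcs T"
proof (rule ccontr)
  assume no: "\<not> ?thesis"
  obtain d where d: "d \<in> D" using branch_nonempty[OF D] by blast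
  then have "(d, x) \<in> (parcs T)\<^sup>*" using branch_subset[OF D] x by (intro connected) auto
  then have "x \<in> D"
  proof (induction)
    case (step y z)
    then show ?case using no branch_closed[OF D, of y z] arc_sym by blast
  qed (rule d)
  then show False using branch_subset[OF D] by blast
qed

lemma branch_subset_branch:
  assumes D: "D \<in> branches T x" and u: "u \<notin> D" and D': "D' \<in> branches T u" and a: "a \<in> D" "a \<in> D'"
  shows "D \<subseteq> D'"
proof
  fix b assume "b \<in> D"
  with branch_connected[OF D a(1)] have "(a, b) \<in> (parcs T \<inter> D \<times> D)\<^sup>*" by blast
  then have "(a, b) \<in> (arcs_avoiding u)\<^sup>*"
    by (rule rtrancl_mono[THEN subsetD, rotated]) (use u in \<open>auto simp: arcs_avoiding_def\<close>)
  then show "b \<in> D'" using branch_eq_reachable[OF D' a(2)] by auto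
qed

text \<open>
  The branch \<open>D\<close> at \<open>x\<close> together with \<open>x\<close> is connected and avoids \<open>u\<close>, so it lies on a single
  side of \<open>u\<close>.
\<close>

lemma branch_subset_branch_containing:
  assumes D: "D \<in> branches T x" and u: "u \<notin> D" and D': "D' \<in> branches T u" and x: "x \<in> D'"
  shows "D \<subseteq> D'"
proof -
  have "x \<in> pverts T" using branch_subset[OF D'] x by auto
  from branch_has_neighbour[OF D this] obtain z where z: "z \<in> D" "(x, z) \<in> parcs T" by blast
  then have "z \<in> D'" using branch_closed[OF D' x z(2)] u by auto
  with branch_subset_branch[OF D u D' z(1)] show ?thesis by blast
qed

lemma rtrancl_imp_awalk:
  assumes "(a, b) \<in> S\<^sup>*" "S \<subseteq> parcs T" "a \<in> pverts T"
  shows "\<exists>p. awalk a p b \<and> set p \<subseteq> S"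
  using assms(1)
proof induction
  case base
  show ?case using assms(3) by (intro exI[of _ "[]"]) (simp add: awalk_Nil_iff)
next
  case (step b c)
  then obtain p where p: "awalk a p b" "set p \<subseteq> S" by blast
  have "awalk b [(b, c)] c" using step assms(2) by (auto simp: awalk_simps dest: in_arcsD2)
  with p step show ?case by (intro exI[of _ "p @ [(b, c)]"]) auto
qed

text \<open>
  The only use of acyclicity. A walk from \<open>u\<close> to \<open>v\<close> that does not use the edge contains a
  path of length at least two; together with the arc back to \<open>u\<close> it is a cycle of length at
  least three.
\<close>

lemma edge_is_bridge:
  assumes uv: "(u, v) \<in> parcs T"
  shows "(u, v) \<notin> (parcs T - {(u, v), (v, u)})\<^sup>*"
proof
  assume "(u, v) \<in> (parcs T - {(u, v), (v, u)})\<^sup>*"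
  from rtrancl_imp_awalk[OF this] obtain p where
    p: "awalk u p v" "set p \<subseteq> parcs T - {(u, v), (v, u)}"
    using uv in_arcsD1 by blast
  define q where "q = awalk_to_apath p"
  have q: "apath u q v" "set q \<subseteq> parcs T - {(u, v), (v, u)}"
    using apath_awalk_to_apath[OF p(1)] awalk_to_apath_subset[OF p(1)] p(2) by (auto simp: q_def)
  have "length q \<ge> 2"
  proof (cases q)
    case Nil
    then show ?thesis using q arc_neq[OF uv] by (simp add: apath_Nil_iff)
  next
    case (Cons e q')
    then show ?thesis using q by (cases q') (auto simp: apath_simps)
  qed
  have vu: "awalk v [(v, u)] u" using arc_sym[OF uv] by (auto simp: awalk_simps dest: in_arcsD2)
  have "awalk u (q @ [(v, u)]) u" using q vu by (auto simp: apath_def)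
  moreover have "distinct (tl (awalk_verts u (q @ [(v, u)])))"
  proof -
    have "awalk_verts u (q @ [(v, u)]) = awalk_verts u q @ [u]"
      using awalk_verts_append[OF \<open>awalk u (q @ [(v, u)]) u\<close>] by simp
    moreover have "distinct (awalk_verts u q)" "hd (awalk_verts u q) = u" "awalk_verts u q \<noteq> []"
      using q by (auto simp: apath_def)
    ultimately show ?thesis by (cases "awalk_verts u q") auto
  qed
  ultimately have "cycle (q @ [(v, u)])" unfolding cycle_def by blast
  moreover have "length (q @ [(v, u)]) \<ge> 3" using \<open>length q \<ge> 2\<close> by simp
  ultimately show False using tree unfolding tree_graph_def by blast
qed

text \<open>A common vertex could be reached from both ends of the edge without the edge.\<close>

lemma opposite_branches_disjoint:
  assumes uv: "(u, v) \<in> parcs T" and B: "B \<in> branches T v" "u \<in> B" and B': "B' \<in> branches T u" "v \<in> B'"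
  shows "B \<inter> B' = {}"
proof (rule ccontr)
  let ?R = "parcs T - {(u, v), (v, u)}"
  assume "\<not> ?thesis"
  then obtain x where x: "x \<in> B" "x \<in> B'" by blast
  have "(u, x) \<in> (arcs_avoiding v)\<^sup>*" using branch_eq_reachable[OF B] x by auto
  then have "(u, x) \<in> ?R\<^sup>*" by (rule rtrancl_mono[THEN subsetD, rotated]) (auto simp: arcs_avoiding_def)
  moreover have "(x, v) \<in> (arcs_avoiding u)\<^sup>*" using branch_eq_reachable[OF B'(1) x(2)] B' by auto
  then have "(x, v) \<in> ?R\<^sup>*" by (rule rtrancl_mono[THEN subsetD, rotated]) (auto simp: arcs_avoiding_def)
  ultimately have "(u, v) \<in> ?R\<^sup>*" by (rule rtrancl_trans)
  with edge_is_bridge[OF uv] show False by blast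
qed

end

section \<open>The quadratic form of the block Laplacian\<close>

locale weighted_tree = finite_tree T for T :: "'a pair_pre_digraph" +
  fixes W :: "'a set \<Rightarrow> real mat" and s :: nat and vs :: "'a list"
  assumes s_pos: "1 \<le> s"
    and weight_pos_def: "(u, v) \<in> parcs T \<Longrightarrow> pos_def_mat s (W {u, v})"
    and distinct_vs: "distinct vs"
    and set_vs: "set vs = pverts T"
begin

definition N :: nat where "N = length vs * s"

definition L :: "real mat" where "L = laplacian T W s vs"

definition pos :: "'a \<Rightarrow> nat" where "pos a = (THE p. p < length vs \<and> vs ! p = a)"

definition idx :: "'a \<Rightarrow> nat \<Rightarrow> nat" where "idx a i = pos a * s + i"

definition blk :: "real vec \<Rightarrow> 'a \<Rightarrow> real vec" where "blk x a = vec s (\<lambda>i. x $ idx a i)"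

lemma pos:
  assumes "a \<in> pverts T"
  shows "pos a < length vs" "vs ! pos a = a"
proof -
  have "\<exists>!p. p < length vs \<and> vs ! p = a"
    using assms distinct_Ex1[OF distinct_vs] set_vs by metis
  from theI'[OF this] show "pos a < length vs" "vs ! pos a = a" by (simp_all add: pos_def)
qed

lemma pos_nth: "p < length vs \<Longrightarrow> pos (vs ! p) = p"
  using pos[of "vs ! p"] set_vs nth_mem[of p vs] nth_eq_iff_index_eq[OF distinct_vs, of "pos (vs ! p)" p]
  by simp

lemma idx_less: "a \<in> pverts T \<Longrightarrow> i < s \<Longrightarrow> idx a i < N"
proof -
  assume a: "a \<in> pverts T" and i: "i < s"
  have "idx a i < (pos a + 1) * s" using i by (simp add: idx_def)
  also have "\<dots> \<le> N" unfolding N_def using pos[OF a] by (intro mult_le_mono1) simp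
  finally show ?thesis .
qed

lemma idx_div_mod: "i < s \<Longrightarrow> idx a i div s = pos a" "i < s \<Longrightarrow> idx a i mod s = i"
  by (simp_all add: idx_def)

lemma index_of_less_N:
  assumes "k < N"
  shows "k div s < length vs" "vs ! (k div s) \<in> pverts T" "k mod s < s" "idx (vs ! (k div s)) (k mod s) = k"
proof -
  show 1: "k div s < length vs" using assms by (simp add: N_def less_mult_imp_div_less)
  then show "vs ! (k div s) \<in> pverts T" using set_vs nth_mem by blast
  show "k mod s < s" using s_pos by simp
  show "idx (vs ! (k div s)) (k mod s) = k" using pos_nth[OF 1] by (simp add: idx_def)
qed

lemma sum_over_blocks: "(\<Sum>k<N. g k) = (\<Sum>a\<in>pverts T. \<Sum>i<s. g (idx a i))"
proof -
  have "(\<Sum>k<N. g k) = (\<Sum>(a, i)\<in>pverts T \<times> {..<s}. g (idx a i))"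
    by (rule sum.reindex_bij_witness[where i = "\<lambda>(a, i). idx a i" and j = "\<lambda>k. (vs ! (k div s), k mod s)"])
      (auto simp: index_of_less_N idx_less idx_div_mod pos)
  then show ?thesis by (simp add: sum.cartesian_product)
qed

lemma block_indices_subset: "block_indices s vs U \<subseteq> {..<N}"
  by (auto simp: block_indices_def N_def)

lemma idx_in_block_indices: "a \<in> pverts T \<Longrightarrow> i < s \<Longrightarrow> idx a i \<in> block_indices s vs U \<longleftrightarrow> a \<in> U"
  using idx_less[of a i] by (simp add: block_indices_def N_def idx_div_mod pos)

lemma L_carrier: "L \<in> carrier_mat N N"
  by (simp add: L_def laplacian_def N_def)

lemma L_idx:
  assumes "a \<in> pverts T" "b \<in> pverts T" "i < s" "j < s"
  shows "L $$ (idx a i, idx b j) = laplacian_block T W s a b $$ (i, j)"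
  using idx_less[OF assms(1,3)] idx_less[OF assms(2,4)] assms
  by (simp add: L_def laplacian_def N_def idx_div_mod pos)

lemma weight_carrier: "(u, v) \<in> parcs T \<Longrightarrow> W {u, v} \<in> carrier_mat s s"
  and weight_sym: "(u, v) \<in> parcs T \<Longrightarrow> (W {u, v})\<^sup>T = W {u, v}"
  using weight_pos_def by (auto simp: pos_def_mat_def)

lemma weight_entry_sym: "(u, v) \<in> parcs T \<Longrightarrow> i < s \<Longrightarrow> j < s \<Longrightarrow> W {u, v} $$ (i, j) = W {u, v} $$ (j, i)"
  using weight_carrier[of u v] weight_sym[of u v] index_transpose_mat(1)[of j "W {u, v}" i] by auto

lemma laplacian_block_sym:
  assumes "i < s" "j < s"
  shows "laplacian_block T W s a b $$ (i, j) = laplacian_block T W s b a $$ (j, i)"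
proof -
  have "(\<Sum>w | (b, w) \<in> parcs T. W {b, w} $$ (i, j)) = (\<Sum>w | (b, w) \<in> parcs T. W {b, w} $$ (j, i))"
    using assms by (intro sum.cong) (auto simp: weight_entry_sym)
  moreover have "(- W {a, b}) $$ (i, j) = (- W {b, a}) $$ (j, i)" if "(a, b) \<in> parcs T"
    using weight_carrier[OF that] weight_entry_sym[OF that assms] assms by (simp add: insert_commute)
  ultimately show ?thesis using assms arc_sym by (auto simp: laplacian_block_def)
qed

lemma L_sym: "L\<^sup>T = L"
proof (rule eq_matI)
  fix k l assume kl: "k < dim_row L" "l < dim_col L"
  then have k: "k < N" and l: "l < N" using L_carrier by auto
  have "L\<^sup>T $$ (k, l) = L $$ (l, k)" using kl L_carrier by simp
  also have "\<dots> = L $$ (k, l)"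
    using L_idx[OF index_of_less_N(2)[OF k] index_of_less_N(2)[OF l] index_of_less_N(3)[OF k] index_of_less_N(3)[OF l]]
      L_idx[OF index_of_less_N(2)[OF l] index_of_less_N(2)[OF k] index_of_less_N(3)[OF l] index_of_less_N(3)[OF k]]
      laplacian_block_sym[OF index_of_less_N(3)[OF k] index_of_less_N(3)[OF l]]
      index_of_less_N(4)[OF k] index_of_less_N(4)[OF l]
    by simp
  finally show "L\<^sup>T $$ (k, l) = L $$ (k, l)" .
qed (use L_carrier in auto)

lemma blk_carrier: "blk x a \<in> carrier_vec s"
  by (simp add: blk_def)

lemma scalar_prod_blocks:
  assumes "x \<in> carrier_vec N" "y \<in> carrier_vec N"
  shows "x \<bullet> y = (\<Sum>a\<in>pverts T. blk x a \<bullet> blk y a)"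
  using assms sum_over_blocks[of "\<lambda>k. x $ k * y $ k"]
  by (simp add: scalar_prod_def blk_def atLeast0LessThan)

lemma finite_neighbours: "finite {w. (a, w) \<in> parcs T}"
  by (rule finite_subset[OF _ pair_finite_verts]) (auto dest: in_arcsD2)

text \<open>
  The diagonal block is the sum of the weights of the incident edges, so it combines with the
  blocks off the diagonal to differences along these edges.
\<close>

lemma laplacian_mult_entry:
  assumes x: "x \<in> carrier_vec N" and a: "a \<in> pverts T" and i: "i < s"
  shows "(L *\<^sub>v x) $ idx a i =
    (\<Sum>w | (a, w) \<in> parcs T. (W {a, w} *\<^sub>v (blk x a - blk x w)) $ i)"
proof -
  let ?E = "{w. (a, w) \<in> parcs T}"
  let ?l = "\<lambda>b. \<Sum>j<s. laplacian_block T W s a b $$ (i, j) * x $ idx b j"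
  have E: "?E \<subseteq> pverts T - {a}" using arc_neq by (auto dest: in_arcsD2)
  have "(L *\<^sub>v x) $ idx a i = (\<Sum>b\<in>pverts T. ?l b)"
    using x a i L_carrier idx_less[OF a i] sum_over_blocks[of "\<lambda>k. L $$ (idx a i, k) * x $ k"]
    by (simp add: scalar_prod_def atLeast0LessThan L_idx)
  also have "\<dots> = ?l a + (\<Sum>b\<in>pverts T - {a}. ?l b)"
    by (rule sum.remove[OF pair_finite_verts a])
  also have "(\<Sum>b\<in>pverts T - {a}. ?l b) = (\<Sum>w\<in>?E. ?l w)"
    using E i by (intro sum.mono_neutral_right) (auto simp: laplacian_block_def pair_finite_verts)
  also have "?l a = (\<Sum>w\<in>?E. \<Sum>j<s. W {a, w} $$ (i, j) * x $ idx a j)"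
    using i by (simp add: laplacian_block_def sum_distrib_right sum.swap[of _ ?E])
  also have "\<dots> + (\<Sum>w\<in>?E. ?l w) =
      (\<Sum>w\<in>?E. (\<Sum>j<s. W {a, w} $$ (i, j) * x $ idx a j) + ?l w)"
    by (rule sum.distrib[symmetric])
  also have "\<dots> = (\<Sum>w\<in>?E. (W {a, w} *\<^sub>v (blk x a - blk x w)) $ i)"
  proof (rule sum.cong)
    fix w assume "w \<in> ?E"
    then have aw: "(a, w) \<in> parcs T" "a \<noteq> w" using arc_neq by auto
    have "?l w = (\<Sum>j<s. - (W {a, w} $$ (i, j) * x $ idx w j))"
      using aw i weight_carrier[OF aw(1)] by (simp add: laplacian_block_def)
    moreover have "(W {a, w} *\<^sub>v (blk x a - blk x w)) $ i =
        (\<Sum>j<s. W {a, w} $$ (i, j) * (x $ idx a j - x $ idx w j))"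
      using i weight_carrier[OF aw(1)] by (simp add: scalar_prod_def blk_def atLeast0LessThan)
    ultimately show "(\<Sum>j<s. W {a, w} $$ (i, j) * x $ idx a j) + ?l w =
        (W {a, w} *\<^sub>v (blk x a - blk x w)) $ i"
      by (simp add: sum.distrib[symmetric] right_diff_distrib)
  qed simp
  finally show ?thesis .
qed

text \<open>
  Each edge corresponds to two arcs, whence the factor 2. The contributions of the opposite
  arcs \<open>(a, b)\<close> and \<open>(b, a)\<close> add up to the form of the weight at the difference of the two
  blocks.
\<close>

lemma laplacian_quad_form:
  assumes x: "x \<in> carrier_vec N"
  shows "2 * (x \<bullet> (L *\<^sub>v x)) =
    (\<Sum>(a, b)\<in>parcs T. (blk x a - blk x b) \<bullet> (W {a, b} *\<^sub>v (blk x a - blk x b)))"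
proof -
  let ?q = "\<lambda>a w. blk x a \<bullet> (W {a, w} *\<^sub>v (blk x a - blk x w))"
  have dim: "dim_vec (blk x a) = s" for a using blk_carrier[of x a] by simp
  have "x \<bullet> (L *\<^sub>v x) = (\<Sum>a\<in>pverts T. \<Sum>i<s. blk x a $ i * (L *\<^sub>v x) $ idx a i)"
    using scalar_prod_blocks[OF x, of "L *\<^sub>v x"] x L_carrier
    by (simp add: scalar_prod_def blk_def atLeast0LessThan)
  also have "\<dots> = (\<Sum>a\<in>pverts T. \<Sum>w | (a, w) \<in> parcs T. ?q a w)"
  proof (rule sum.cong)
    fix a assume a: "a \<in> pverts T"
    have "(\<Sum>i<s. blk x a $ i * (L *\<^sub>v x) $ idx a i) =
        (\<Sum>w | (a, w) \<in> parcs T. \<Sum>i<s. blk x a $ i * (W {a, w} *\<^sub>v (blk x a - blk x w)) $ i)"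
      using laplacian_mult_entry[OF x a] by (simp add: sum_distrib_left sum.swap[of _ "{..<s}"])
    also have "\<dots> = (\<Sum>w | (a, w) \<in> parcs T. ?q a w)"
    proof (rule sum.cong)
      fix w assume "w \<in> {w. (a, w) \<in> parcs T}"
      then have "W {a, w} *\<^sub>v (blk x a - blk x w) \<in> carrier_vec s"
        using weight_carrier by (intro mult_mat_vec_carrier[of _ s s]) (auto simp: blk_def)
      then show "(\<Sum>i<s. blk x a $ i * (W {a, w} *\<^sub>v (blk x a - blk x w)) $ i) = ?q a w"
        by (simp only: scalar_prod_def carrier_vecD atLeast0LessThan)
    qed simp
    finally show "(\<Sum>i<s. blk x a $ i * (L *\<^sub>v x) $ idx a i) = (\<Sum>w | (a, w) \<in> parcs T. ?q a w)" .
  qed simp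
  also have "\<dots> = (\<Sum>(a, w)\<in>(SIGMA a:pverts T. {w. (a, w) \<in> parcs T}). ?q a w)"
    by (rule sum.Sigma) (auto simp: pair_finite_verts finite_neighbours)
  also have "(SIGMA a:pverts T. {w. (a, w) \<in> parcs T}) = parcs T" by (auto dest: in_arcsD1)
  finally have 1: "x \<bullet> (L *\<^sub>v x) = (\<Sum>(a, w)\<in>parcs T. ?q a w)" .
  also have "\<dots> = (\<Sum>(a, w)\<in>parcs T. ?q w a)"
    by (rule sum.reindex_bij_witness[where i = prod.swap and j = prod.swap]) (auto simp: arc_sym)
  finally have "2 * (x \<bullet> (L *\<^sub>v x)) = (\<Sum>(a, w)\<in>parcs T. ?q a w + ?q w a)"
    using 1 by (simp add: sum.distrib split_def)
  also have "\<dots> = (\<Sum>(a, b)\<in>parcs T. (blk x a - blk x b) \<bullet> (W {a, b} *\<^sub>v (blk x a - blk x b)))"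
  proof (rule sum.cong)
    fix e assume "e \<in> parcs T"
    then obtain a b where e: "e = (a, b)" "(a, b) \<in> parcs T" by (cases e) auto
    note c = weight_carrier[OF e(2)] blk_carrier[of x a] blk_carrier[of x b]
    have "?q b a = - (blk x b \<bullet> (W {a, b} *\<^sub>v (blk x a - blk x b)))"
    proof -
      have "W {b, a} *\<^sub>v (blk x b - blk x a) = - (W {a, b} *\<^sub>v (blk x a - blk x b))"
        using c by (intro eq_vecI)
          (auto simp: insert_commute[of b a] scalar_prod_def sum_negf[symmetric] algebra_simps intro!: sum.cong)
      then show ?thesis using c by simp
    qed
    then have "?q a b + ?q b a = (blk x a - blk x b) \<bullet> (W {a, b} *\<^sub>v (blk x a - blk x b))"
      using c by (simp add: minus_scalar_prod_distrib[of _ s])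
    then show "(case e of (a, w) \<Rightarrow> ?q a w + ?q w a) =
      (case e of (a, b) \<Rightarrow> (blk x a - blk x b) \<bullet> (W {a, b} *\<^sub>v (blk x a - blk x b)))"
      using e by simp
  qed simp
  finally show ?thesis .
qed

lemma weight_quad_nonneg:
  assumes "(a, b) \<in> parcs T" "y \<in> carrier_vec s"
  shows "0 \<le> y \<bullet> (W {a, b} *\<^sub>v y)" and "y \<bullet> (W {a, b} *\<^sub>v y) = 0 \<Longrightarrow> y = 0\<^sub>v s"
proof -
  have "y = 0\<^sub>v s \<or> 0 < y \<bullet> (W {a, b} *\<^sub>v y)"
    using weight_pos_def[OF assms(1)] assms(2) by (auto simp: pos_def_mat_def)
  then show "0 \<le> y \<bullet> (W {a, b} *\<^sub>v y)" "y \<bullet> (W {a, b} *\<^sub>v y) = 0 \<Longrightarrow> y = 0\<^sub>v s"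
    using weight_carrier[OF assms(1)] by auto
qed

lemma laplacian_quad_nonneg: "x \<in> carrier_vec N \<Longrightarrow> 0 \<le> x \<bullet> (L *\<^sub>v x)"
proof -
  assume x: "x \<in> carrier_vec N"
  have "0 \<le> 2 * (x \<bullet> (L *\<^sub>v x))"
    unfolding laplacian_quad_form[OF x] using blk_carrier
    by (intro sum_nonneg) (auto intro!: weight_quad_nonneg(1))
  then show ?thesis by simp
qed

text \<open>
  If the energy vanishes, then so do all differences along edges, and \<open>x\<close> is constant on the
  connected graph, hence equal to its value 0 at \<open>v\<close>.
\<close>

lemma laplacian_quad_eq_0D:
  assumes x: "x \<in> carrier_vec N" and 0: "x \<bullet> (L *\<^sub>v x) = 0"
    and v: "v \<in> pverts T" and sup: "supported_on (block_indices s vs (pverts T - {v})) x"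
  shows "x = 0\<^sub>v N"
proof (rule eq_vecI)
  fix k assume "k < dim_vec (0\<^sub>v N :: real vec)"
  then have k: "k < N" by simp
  let ?f = "\<lambda>(a, b). (blk x a - blk x b) \<bullet> (W {a, b} *\<^sub>v (blk x a - blk x b))"
  have "sum ?f (parcs T) = 0" using laplacian_quad_form[OF x] 0 by simp
  moreover have "\<And>e. e \<in> parcs T \<Longrightarrow> 0 \<le> ?f e" using blk_carrier by (auto intro!: weight_quad_nonneg(1))
  ultimately have f0: "\<And>e. e \<in> parcs T \<Longrightarrow> ?f e = 0"
    using sum_nonneg_eq_0_iff[OF pair_finite_arcs, of ?f] by blast
  have const: "blk x a = blk x b" if ab: "(a, b) \<in> parcs T" for a b
  proof -
    have "blk x a - blk x b = 0\<^sub>v s"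
      using weight_quad_nonneg(2)[OF ab, of "blk x a - blk x b"] f0[OF ab] blk_carrier by auto
    then have "(blk x a - blk x b) $ i = 0" if "i < s" for i using that by simp
    then show ?thesis by (intro eq_vecI) (auto simp: blk_def)
  qed
  let ?a = "vs ! (k div s)"
  have "(v, ?a) \<in> (parcs T)\<^sup>*" using v index_of_less_N(2)[OF k] by (rule connected)
  then have "blk x ?a = blk x v" by (induction) (auto dest: const)
  moreover have "blk x v = 0\<^sub>v s"
  proof (rule eq_vecI)
    fix i assume "i < dim_vec (0\<^sub>v s :: real vec)"
    then have i: "i < s" by simp
    then show "blk x v $ i = 0\<^sub>v s $ i"
      using supported_onD[OF sup x idx_less[OF v i]] idx_in_block_indices[OF v i] by (simp add: blk_def)
  qed (simp add: blk_def)
  ultimately have "blk x ?a $ (k mod s) = 0" using index_of_less_N(3)[OF k] by simp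
  then show "x $ k = 0\<^sub>v N $ k" using k index_of_less_N(3,4)[OF k] by (simp add: blk_def)
qed (use x in simp)

end

section \<open>Grounded potentials and bottleneck matrices\<close>

context weighted_tree begin

text \<open>
  These index sets refer to the full enumeration \<open>vs\<close>; the blocks of a reduced matrix are
  enumerated by \<^term>\<open>removeAll v vs\<close> instead.
\<close>

definition I :: "'a set \<Rightarrow> nat set" where "I U = block_indices s vs U"

abbreviation off :: "'a \<Rightarrow> nat set" where "off v \<equiv> I (pverts T - {v})"

definition M :: "'a \<Rightarrow> real mat" where "M v = inverse_reduced_laplacian T W s vs v"

lemma I_subset: "I U \<subseteq> {..<N}"
  unfolding I_def by (rule block_indices_subset)

lemma I_mono: "U \<subseteq> U' \<Longrightarrow> I U \<subseteq> I U'"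
  by (auto simp: I_def block_indices_def)

lemma mem_I_iff: "k < N \<Longrightarrow> k \<in> I U \<longleftrightarrow> vs ! (k div s) \<in> U"
  by (simp add: I_def block_indices_def N_def)

lemma laplacian_pos_semidef: "pos_semidef_mat N L"
  using L_carrier L_sym laplacian_quad_nonneg by (simp add: pos_semidef_mat_def)

text \<open>
  The reduced Laplacian is nonsingular: a vector in its kernel, extended by 0 at \<open>v\<close>, has
  energy 0. Hence the matrix inverse in the definition really exists.
\<close>

lemma M_inverse:
  assumes v: "v \<in> pverts T"
  defines "S \<equiv> submatrix L (off v) (off v)" and "m \<equiv> card (off v)"
  shows "M v \<in> carrier_mat m m" "S * M v = 1\<^sub>m m" "M v * S = 1\<^sub>m m"
proof -
  have S: "S \<in> carrier_mat m m" unfolding S_def m_def by (rule submatrix_carrier[OF L_carrier I_subset])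
  have "det S \<noteq> 0"
  proof
    assume "det S = 0"
    then obtain y where y: "y \<in> carrier_vec m" "y \<noteq> 0\<^sub>v m" "S *\<^sub>v y = 0\<^sub>v m"
      using det_0_iff_vec_prod_zero[OF S] by blast
    let ?x = "extend_vec N (off v) y"
    have x: "?x \<in> carrier_vec N" "supported_on (off v) ?x"
      by (rule extend_vec_carrier supported_on_extend_vec)+
    have r: "restrict_vec (off v) ?x = y" using restrict_extend_vec[OF I_subset] y(1) by (simp add: m_def)
    have "?x \<bullet> (L *\<^sub>v ?x) = 0"
      using submatrix_quad_form[OF L_carrier I_subset x] r y by (simp add: S_def)
    then have "?x = 0\<^sub>v N" using laplacian_quad_eq_0D[OF x(1) _ v] x(2) by (simp add: I_def)
    then have "restrict_vec (off v) ?x = 0\<^sub>v m"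
      using pick_less[OF I_subset, of _ "pverts T - {v}"] by (auto simp: restrict_vec_def m_def)
    then show False using r y by simp
  qed
  then have unit: "S \<in> Units (ring_mat TYPE(real) m ())" by (rule det_non_zero_imp_unit[OF S])
  have "M v = the (mat_inverse S)"
    by (simp add: M_def inverse_reduced_laplacian_def reduced_laplacian_def principal_blocks_def S_def
        I_def L_def)
  then obtain "mat_inverse S = Some (M v)" using mat_inverse(1)[OF S, of "()"] unit by (cases "mat_inverse S") auto
  from mat_inverse(2)[OF S this]
  show "M v \<in> carrier_mat m m" "S * M v = 1\<^sub>m m" "M v * S = 1\<^sub>m m" by auto
qed

text \<open>
  With \<open>z = M y\<close> the form of \<open>M\<close> at \<open>y\<close> is the energy of \<open>z\<close>.
\<close>

lemma M_pos_semidef: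
  assumes v: "v \<in> pverts T"
  shows "pos_semidef_mat (card (off v)) (M v)"
proof -
  let ?S = "submatrix L (off v) (off v)" and ?m = "card (off v)"
  note M = M_inverse[OF v]
  have S: "?S \<in> carrier_mat ?m ?m" "?S\<^sup>T = ?S"
    using pos_semidef_submatrix[OF laplacian_pos_semidef I_subset] by (auto simp: pos_semidef_mat_def)
  have "(M v)\<^sup>T * ?S = 1\<^sub>m ?m"
    using transpose_mult[OF S(1) M(1)] M(2) S(2) by simp
  then have "(M v)\<^sup>T = M v"
    using assoc_mult_mat[of "(M v)\<^sup>T" ?m ?m ?S ?m "M v" ?m] M S by simp
  moreover have "0 \<le> y \<bullet> (M v *\<^sub>v y)" if y: "y \<in> carrier_vec ?m" for y
  proof -
    have z: "M v *\<^sub>v y \<in> carrier_vec ?m" using M(1) y by simp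
    have "?S *\<^sub>v (M v *\<^sub>v y) = y" using assoc_mult_mat_vec[OF S(1) M(1) y] M(2) y by simp
    then have "y \<bullet> (M v *\<^sub>v y) = (M v *\<^sub>v y) \<bullet> (?S *\<^sub>v (M v *\<^sub>v y))"
      using comm_scalar_prod[OF y z] by simp
    also have "\<dots> \<ge> 0"
      using pos_semidef_submatrix[OF laplacian_pos_semidef I_subset] z by (auto simp: pos_semidef_mat_def)
    finally show ?thesis .
  qed
  ultimately show ?thesis using M(1) by (simp add: pos_semidef_mat_def)
qed

text \<open>
  The solution of \<open>L y = f\<close> off \<open>v\<close> that vanishes at \<open>v\<close>: \<open>f\<close> is a current injected into the
  network, \<open>v\<close> is the ground, and \<open>f \<bullet> potential v f\<close> is the energy of the flow.
\<close>

definition potential :: "'a \<Rightarrow> real vec \<Rightarrow> real vec" where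
  "potential v f = extend_vec N (off v) (M v *\<^sub>v restrict_vec (off v) f)"

lemma potential_carrier: "potential v f \<in> carrier_vec N"
  and potential_grounded: "supported_on (off v) (potential v f)"
  unfolding potential_def by (rule extend_vec_carrier supported_on_extend_vec)+

lemma restrict_potential:
  "v \<in> pverts T \<Longrightarrow> restrict_vec (off v) (potential v f) = M v *\<^sub>v restrict_vec (off v) f"
  unfolding potential_def using M_inverse(1)
  by (intro restrict_extend_vec I_subset) (auto intro!: mult_mat_vec_carrier restrict_vec_carrier)

text \<open>
  At \<open>v\<close> itself the equation fails in general: there the current flows into the ground.
\<close>

lemma laplacian_potential:
  assumes v: "v \<in> pverts T" and k: "k \<in> off v"
  shows "(L *\<^sub>v potential v f) $ k = f $ k"
proof -
  let ?S = "submatrix L (off v) (off v)" and ?m = "card (off v)" and ?r = "restrict_vec (off v)"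
  have S: "?S \<in> carrier_mat ?m ?m" by (rule submatrix_carrier[OF L_carrier I_subset])
  note M = M_inverse[OF v]
  have "?r (L *\<^sub>v potential v f) = ?S *\<^sub>v (M v *\<^sub>v ?r f)"
    using submatrix_mult_restrict_vec[OF L_carrier I_subset potential_carrier potential_grounded, of v f]
      restrict_potential[OF v, of f] by simp
  also have "\<dots> = ?r f"
    using assoc_mult_mat_vec[OF S M(1) restrict_vec_carrier, of f] M(2) restrict_vec_carrier[of "off v" f] by simp
  finally have eq: "?r (L *\<^sub>v potential v f) = ?r f" .
  have "finite (off v)" using I_subset finite_subset by blast
  from pick_obtain[OF this k] obtain l where l: "l < ?m" "pick (off v) l = k" .
  from arg_cong[OF eq, of "\<lambda>y. y $ l"] l show ?thesis by (simp add: restrict_vec_def)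
qed

lemma scalar_prod_cong_supported:
  assumes "y \<in> carrier_vec N" "supported_on (I U) y" "g \<in> carrier_vec N" "h \<in> carrier_vec N"
    and "\<And>k. k \<in> I U \<Longrightarrow> g $ k = h $ k"
  shows "y \<bullet> g = y \<bullet> h"
  using scalar_prod_supported[OF assms(1,2,3) I_subset] scalar_prod_supported[OF assms(1,2,4) I_subset] assms(5)
  by simp

text \<open>
  The matrix \<open>M v\<close> is block diagonal. Let \<open>z'\<close> be the part of the potential outside \<open>D\<close>. No
  edge joins its support to \<open>D\<close>, as the only neighbour of \<open>D\<close> outside \<open>D\<close> is the grounded
  vertex \<open>v\<close>. So the energy of \<open>z'\<close> is \<open>z' \<bullet> f\<close>, which vanishes because \<open>f\<close> is supported on
  \<open>D\<close>.
\<close>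

lemma potential_supported_on_branch:
  assumes v: "v \<in> pverts T" and D: "D \<in> branches T v"
    and f: "f \<in> carrier_vec N" "supported_on (I D) f"
  shows "supported_on (I D) (potential v f)"
proof -
  let ?z = "potential v f"
  define z' where "z' = vec N (\<lambda>k. if k \<in> I D then 0 else ?z $ k)"
  have z: "?z \<in> carrier_vec N" by (rule potential_carrier)
  have z': "z' \<in> carrier_vec N" by (simp add: z'_def)
  have DV: "D \<subseteq> pverts T - {v}" by (rule branch_subset[OF D])
  have sup: "supported_on (I (pverts T - {v} - D)) z'"
    unfolding supported_on_def
  proof (intro allI impI)
    fix k assume k: "k < dim_vec z'" "k \<notin> I (pverts T - {v} - D)"
    then have kN: "k < N" by (simp add: z'_def)
    show "z' $ k = 0"
      using k(2) kN supported_onD[OF potential_grounded z kN] by (auto simp: z'_def mem_I_iff)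
  qed
  have 1: "z' \<bullet> (L *\<^sub>v ?z) = 0"
  proof -
    have "z' \<bullet> (L *\<^sub>v ?z) = z' \<bullet> 0\<^sub>v N"
    proof (rule scalar_prod_cong_supported[OF z' sup])
      fix k assume k: "k \<in> I (pverts T - {v} - D)"
      then have kN: "k < N" using I_subset by blast
      have "k \<in> off v" "k \<notin> I D" using k kN by (auto simp: mem_I_iff)
      then show "(L *\<^sub>v ?z) $ k = 0\<^sub>v N $ k"
        using laplacian_potential[OF v] supported_onD[OF f(2,1) kN] kN by simp
    qed (use L_carrier z in auto)
    then show ?thesis using z' by simp
  qed
  have 2: "z' \<bullet> (L *\<^sub>v (?z - z')) = z' \<bullet> 0\<^sub>v N"
  proof (rule scalar_prod_cong_supported[OF z' sup])
    fix k assume k: "k \<in> I (pverts T - {v} - D)"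
    then have kN: "k < N" using I_subset by blast
    have "L $$ (k, l) * (?z - z') $ l = 0" if l: "l < N" for l
    proof (cases "l \<in> I D")
      case False
      then show ?thesis using l z by (simp add: z'_def)
    next
      case True
      let ?a = "vs ! (k div s)" and ?b = "vs ! (l div s)"
      have a: "?a \<notin> D" "?a \<noteq> v" and b: "?b \<in> D" using k True kN l by (auto simp: mem_I_iff)
      then have "(?a, ?b) \<notin> parcs T" using branch_closed[OF D b, of ?a] arc_sym by blast
      moreover have "?a \<noteq> ?b" using a b by auto
      ultimately have "laplacian_block T W s ?a ?b = 0\<^sub>m s s" by (simp add: laplacian_block_def)
      then have "L $$ (k, l) = 0"
        using L_idx[OF index_of_less_N(2)[OF kN] index_of_less_N(2)[OF l] index_of_less_N(3)[OF kN] index_of_less_N(3)[OF l]]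
          index_of_less_N(3,4)[OF kN] index_of_less_N(3,4)[OF l] by simp
      then show ?thesis by simp
    qed
    then show "(L *\<^sub>v (?z - z')) $ k = 0\<^sub>v N $ k"
      using kN L_carrier z z' by (auto simp: scalar_prod_def intro!: sum.neutral)
  qed (use L_carrier z z' in auto)
  have "?z - (?z - z') = z'" using z z' by (intro eq_vecI) auto
  then have "L *\<^sub>v z' = L *\<^sub>v ?z - L *\<^sub>v (?z - z')"
    using mult_minus_distrib_mat_vec[OF L_carrier z, of "?z - z'"] z z' by simp
  then have "z' \<bullet> (L *\<^sub>v z') = 0"
    using 1 2 z z' L_carrier by (simp add: scalar_prod_minus_distrib[of _ N])
  then have "z' = 0\<^sub>v N"
    using laplacian_quad_eq_0D[OF z' _ v] supported_on_mono[OF sup I_mono, of "pverts T - {v}"]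
    by (auto simp: I_def)
  then have z'_0: "z' $ k = 0" if "k < N" for k using that by simp
  show ?thesis
    unfolding supported_on_def
  proof (intro allI impI)
    fix k assume "k < dim_vec ?z" "k \<notin> I D"
    then show "?z $ k = 0" using z'_0[of k] z by (simp add: z'_def)
  qed
qed

text \<open>
  Moving the ground away from the branch does not decrease the energy. The potential \<open>y\<close>
  grounded at \<open>x\<close> vanishes at \<open>u\<close> as well, so it is an admissible test vector for the problem
  grounded at \<open>u\<close>, and the energy of the difference \<open>z - y\<close> of the two potentials expands to
  \<open>f \<bullet> z - f \<bullet> y\<close>.
\<close>

lemma potential_energy_mono:
  assumes x: "x \<in> pverts T" and u: "u \<in> pverts T" "u \<notin> D" and D: "D \<in> branches T x"
    and f: "f \<in> carrier_vec N" "supported_on (I D) f"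
  shows "f \<bullet> potential x f \<le> f \<bullet> potential u f"
proof -
  let ?y = "potential x f" and ?z = "potential u f"
  have y: "?y \<in> carrier_vec N" and z: "?z \<in> carrier_vec N" by (rule potential_carrier)+
  have Ly: "L *\<^sub>v ?y \<in> carrier_vec N" and Lz: "L *\<^sub>v ?z \<in> carrier_vec N" using L_carrier y z by auto
  \<comment> \<open>So \<open>y\<close> may be used as a test vector for the problem grounded at \<open>u\<close>.\<close>
  have ysup: "supported_on (off u) ?y"
    using potential_supported_on_branch[OF x D f] branch_subset[OF D] u(2)
    by (elim supported_on_mono, intro I_mono) auto
  have yy: "?y \<bullet> (L *\<^sub>v ?y) = ?y \<bullet> f"
    by (rule scalar_prod_cong_supported[OF y potential_grounded Ly f(1) laplacian_potential[OF x]])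
  have zz: "?z \<bullet> (L *\<^sub>v ?z) = ?z \<bullet> f"
    by (rule scalar_prod_cong_supported[OF z potential_grounded Lz f(1) laplacian_potential[OF u(1)]])
  have yz: "?y \<bullet> (L *\<^sub>v ?z) = ?y \<bullet> f"
    by (rule scalar_prod_cong_supported[OF y ysup Lz f(1) laplacian_potential[OF u(1)]])
  \<comment> \<open>The last mixed product follows from the symmetry of \<open>L\<close>.\<close>
  have zy: "?z \<bullet> (L *\<^sub>v ?y) = ?y \<bullet> f"
    using sym_mat_scalar_prod[OF L_carrier L_sym z y] comm_scalar_prod[OF Lz y] yz by simp
  have "0 \<le> (?z - ?y) \<bullet> (L *\<^sub>v (?z - ?y))" using y z by (intro laplacian_quad_nonneg) auto
  also have "L *\<^sub>v (?z - ?y) = L *\<^sub>v ?z - L *\<^sub>v ?y" by (rule mult_minus_distrib_mat_vec[OF L_carrier z y])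
  also have "(?z - ?y) \<bullet> (L *\<^sub>v ?z - L *\<^sub>v ?y) = ?z \<bullet> f - ?y \<bullet> f"
    using y z Ly Lz yy zz yz zy
    by (simp add: minus_scalar_prod_distrib[of _ N] scalar_prod_minus_distrib[of _ N])
  finally show ?thesis using comm_scalar_prod[OF y f(1)] comm_scalar_prod[OF z f(1)] by simp
qed

lemma removeAll_nth:
  assumes v: "v \<in> pverts T" and q: "q < length vs - 1"
  shows "removeAll v vs ! q = vs ! (if q < pos v then q else Suc q)"
proof -
  let ?p = "pos v"
  have p: "?p < length vs" "vs ! ?p = v" by (rule pos[OF v])+
  have "vs = take ?p vs @ v # drop (Suc ?p) vs" using id_take_nth_drop[OF p(1)] p(2) by simp
  moreover from this have "v \<notin> set (take ?p vs)" "v \<notin> set (drop (Suc ?p) vs)"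
    using distinct_vs by (metis distinct.simps(2) distinct_append not_distinct_conv_prefix disjoint_insert(2) list.set(2))+
  ultimately have "removeAll v vs = take ?p vs @ drop (Suc ?p) vs"
    by (metis removeAll.simps(2) removeAll_append removeAll_id)
  then show ?thesis using p(1) q by (simp add: nth_append min_def)
qed

lemma length_removeAll: "v \<in> pverts T \<Longrightarrow> length (removeAll v vs) = length vs - 1"
  using distinct_vs set_vs by (simp add: distinct_remove1_removeAll[symmetric] length_remove1)

definition skip :: "'a \<Rightarrow> nat \<Rightarrow> nat" where "skip v k = (if k < pos v * s then k else k + s)"

text \<open>
  Removing \<open>v\<close> from the enumeration shifts all later indices by one block. The function
  \<open>skip v\<close> is the increasing enumeration of the remaining indices.
\<close>

lemma skip_image:
  assumes v: "v \<in> pverts T"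
  shows "skip v ` {..<(length vs - 1) * s} = off v"
proof (intro subset_antisym subsetI)
  fix k assume "k \<in> skip v ` {..<(length vs - 1) * s}"
  then obtain l where l: "l < (length vs - 1) * s" "k = skip v l" by auto
  have p: "pos v < length vs" by (rule pos[OF v])
  then obtain n where n: "length vs = Suc n" by (cases "length vs") auto
  have pn: "pos v * s \<le> n * s" using p n by simp
  have kN: "k < N" using l n pn by (auto simp: skip_def N_def)
  have "k div s \<noteq> pos v"
  proof (cases "l < pos v * s")
    case True
    then show ?thesis using l(2) less_mult_imp_div_less[OF True] by (simp add: skip_def)
  next
    case False
    then have "pos v \<le> l div s" using s_pos by (simp add: less_eq_div_iff_mult_less_eq)
    then show ?thesis using False l(2) s_pos by (simp add: skip_def)
  qed
  then have "vs ! (k div s) \<noteq> v" using pos_nth[OF index_of_less_N(1)[OF kN]] by auto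
  then show "k \<in> off v" using kN index_of_less_N(2)[OF kN] by (simp add: mem_I_iff)
next
  fix k assume k: "k \<in> off v"
  then have kN: "k < N" using I_subset by blast
  with k have "vs ! (k div s) \<noteq> v" by (simp add: mem_I_iff)
  then have ne: "k div s \<noteq> pos v" using pos(2)[OF v] by auto
  have p: "pos v < length vs" by (rule pos[OF v])
  then obtain n where n: "length vs = Suc n" by (cases "length vs") auto
  have pn: "pos v * s \<le> n * s" using p n by simp
  show "k \<in> skip v ` {..<(length vs - 1) * s}"
  proof (cases "k div s < pos v")
    case True
    then have "k < pos v * s" using s_pos by (simp add: div_less_iff_less_mult)
    moreover have "k < (length vs - 1) * s" using less_le_trans[OF \<open>k < pos v * s\<close> pn] n by simp
    ultimately show ?thesis by (intro image_eqI[of _ _ k]) (auto simp: skip_def)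
  next
    case False
    then have "Suc (pos v) \<le> k div s" using ne by simp
    then have "Suc (pos v) * s \<le> k" using s_pos by (simp add: less_eq_div_iff_mult_less_eq)
    then show ?thesis using kN n by (intro image_eqI[of _ _ "k - s"]) (auto simp: skip_def N_def)
  qed
qed

lemma strict_mono_skip: "strict_mono (skip v)"
  by (rule strict_monoI) (auto simp: skip_def)

lemma card_off: "v \<in> pverts T \<Longrightarrow> card (off v) = (length vs - 1) * s"
  using card_image[of "skip v" "{..<(length vs - 1) * s}"] strict_mono_imp_inj_on[OF strict_mono_skip]
  by (metis card_lessThan inj_on_subset skip_image subset_UNIV)

lemma pick_off:
  assumes v: "v \<in> pverts T" and k: "k < card (off v)"
  shows "pick (off v) k = skip v k"
proof -
  have k': "k < (length vs - 1) * s" using k card_off[OF v] by simp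
  have "{a \<in> off v. a < skip v k} = skip v ` {..<k}"
    using k' strict_mono_less[OF strict_mono_skip, of v] by (auto simp: skip_image[OF v, symmetric])
  then have "card {a \<in> off v. a < skip v k} = k"
    using card_image[OF inj_on_subset[OF strict_mono_imp_inj_on[OF strict_mono_skip] subset_UNIV], of v "{..<k}"] by simp
  moreover have "skip v k \<in> off v" using k' by (auto simp: skip_image[OF v, symmetric])
  ultimately show ?thesis using pick_card_in_set by metis
qed

text \<open>
  The block of \<open>D\<close> in the reduced matrix and its block in the full matrix correspond under the
  enumeration of the rows that remain when \<open>v\<close> is deleted. This identifies the bottleneck
  matrix with a form on vectors indexed by all vertices.
\<close>

lemma block_indices_removeAll:
  assumes v: "v \<in> pverts T"
  shows "block_indices s (removeAll v vs) D = {k. k < card (off v) \<and> pick (off v) k \<in> I D}"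
proof -
  have "removeAll v vs ! (k div s) = vs ! (pick (off v) k div s)" "pick (off v) k < N" if k: "k < card (off v)" for k
  proof -
    have "k div s < length vs - 1" using k card_off[OF v] by (simp add: less_mult_imp_div_less)
    from removeAll_nth[OF v this]
    show "removeAll v vs ! (k div s) = vs ! (pick (off v) k div s)"
      unfolding pick_off[OF v k] using s_pos by (auto simp: skip_def div_less_iff_less_mult)
    show "pick (off v) k < N" by (rule pick_less[OF I_subset k])
  qed
  then show ?thesis
    by (auto simp: block_indices_def length_removeAll[OF v] card_off[OF v] mem_I_iff)
qed

lemma
  assumes v: "v \<in> pverts T" and D: "D \<in> branches T v"
  defines "J \<equiv> block_indices s (removeAll v vs) D"
  shows bottleneck_indices_subset: "J \<subseteq> {..<card (off v)}"
    and bottleneck_indices_nonempty: "J \<noteq> {}"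
    and bottleneck_submatrix: "bottleneck_matrix T W s vs v D = submatrix (M v) J J"
proof -
  show "J \<subseteq> {..<card (off v)}" by (auto simp: J_def block_indices_removeAll[OF v])
  show "bottleneck_matrix T W s vs v D = submatrix (M v) J J"
    by (simp add: bottleneck_matrix_def principal_blocks_def J_def M_def)
  obtain a where a: "a \<in> D" using branch_nonempty[OF D] by blast
  have aV: "a \<in> pverts T" "a \<noteq> v" using a branch_subset[OF D] by auto
  let ?k = "idx a 0"
  have k: "?k \<in> I D" "?k \<in> off v"
    using idx_in_block_indices[OF aV(1), of 0] a aV s_pos by (auto simp: I_def)
  have "finite (off v)" using I_subset finite_subset by blast
  from pick_obtain[OF this k(2)] obtain l where "l < card (off v)" "pick (off v) l = ?k" .
  then show "J \<noteq> {}" using k by (auto simp: J_def block_indices_removeAll[OF v])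
qed

lemma bottleneck_spectral_radius_le:
  assumes "v \<in> pverts T" "D \<in> branches T v"
  shows "real_spectral_radius (bottleneck_matrix T W s vs v D) \<le>
    real_spectral_radius (inverse_reduced_laplacian T W s vs v)"
  using spectral_radius_submatrix_le[OF M_pos_semidef[OF assms(1)] bottleneck_indices_subset[OF assms]
      bottleneck_indices_nonempty[OF assms]] bottleneck_submatrix[OF assms]
  by (simp add: M_def)

text \<open>
  Potentials live on the whole tree, so in this form bottleneck matrices of different branches
  at different vertices become comparable although their dimensions differ.
\<close>

lemma bottleneck_spectral_radius_le_iff:
  assumes v: "v \<in> pverts T" and D: "D \<in> branches T v"
  shows "real_spectral_radius (bottleneck_matrix T W s vs v D) \<le> c \<longleftrightarrow>
    (\<forall>f \<in> carrier_vec N. supported_on (I D) f \<longrightarrow> f \<bullet> potential v f \<le> c * (f \<bullet> f))"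
proof -
  let ?J = "block_indices s (removeAll v vs) D" and ?m = "card (off v)" and ?r = "restrict_vec (off v)"
  have f_off: "supported_on (off v) f" if "supported_on (I D) f" for f
    using that branch_subset[OF D] by (elim supported_on_mono) (rule I_mono)
  have quad: "f \<bullet> potential v f = ?r f \<bullet> (M v *\<^sub>v ?r f)" "f \<bullet> f = ?r f \<bullet> ?r f"
    if f: "f \<in> carrier_vec N" "supported_on (I D) f" for f
    using restrict_vec_scalar_prod[OF f(1) f_off[OF f(2)] potential_carrier I_subset, of v f]
      restrict_vec_scalar_prod[OF f(1) f_off[OF f(2)] f(1) I_subset]
      restrict_potential[OF v, of f] by simp_all
  have "real_spectral_radius (bottleneck_matrix T W s vs v D) \<le> c \<longleftrightarrow>
    (\<forall>y \<in> carrier_vec ?m. supported_on ?J y \<longrightarrow> y \<bullet> (M v *\<^sub>v y) \<le> c * (y \<bullet> y))"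
    using spectral_radius_submatrix_le_iff[OF M_pos_semidef[OF v] bottleneck_indices_subset[OF v D]
        bottleneck_indices_nonempty[OF v D]] bottleneck_submatrix[OF v D] by simp
  also have "\<dots> \<longleftrightarrow>
    (\<forall>f \<in> carrier_vec N. supported_on (I D) f \<longrightarrow> f \<bullet> potential v f \<le> c * (f \<bullet> f))" (is "?L \<longleftrightarrow> ?R")
  proof
    assume L: ?L
    show ?R
    proof (intro ballI impI)
      fix f assume f: "f \<in> carrier_vec N" "supported_on (I D) f"
      have "supported_on ?J (?r f)"
        using supported_onD[OF f(2,1)] pick_less[OF I_subset]
        by (auto simp: supported_on_def restrict_vec_def block_indices_removeAll[OF v])
      with L restrict_vec_carrier quad[OF f] show "f \<bullet> potential v f \<le> c * (f \<bullet> f)" by auto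
    qed
  next
    assume R: ?R
    show ?L
    proof (intro ballI impI)
      fix y :: "real vec" assume y: "y \<in> carrier_vec ?m" "supported_on ?J y"
      let ?f = "extend_vec N (off v) y"
      have ry: "?r ?f = y" by (rule restrict_extend_vec[OF I_subset y(1)])
      have fin: "finite (off v)" using I_subset finite_subset by blast
      have "supported_on (I D) ?f"
        unfolding supported_on_def
      proof (intro allI impI)
        fix k assume k: "k < dim_vec ?f" "k \<notin> I D"
        show "?f $ k = 0"
        proof (cases "k \<in> off v")
          case False
          then show ?thesis using k by (simp add: extend_vec_def)
        next
          case True
          from pick_obtain[OF fin this] obtain l where l: "l < ?m" "pick (off v) l = k" .
          then have "?f $ k = y $ l" using ry by (metis index_vec restrict_vec_def)
          also have "\<dots> = 0"
            using supported_onD[OF y(2,1) l(1)] l k by (simp add: block_indices_removeAll[OF v])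
          finally show ?thesis .
        qed
      qed
      with R quad[OF extend_vec_carrier this] ry extend_vec_carrier show "y \<bullet> (M v *\<^sub>v y) \<le> c * (y \<bullet> y)"
        by metis
    qed
  qed
  finally show ?thesis .
qed

text \<open>
  A current on \<open>D\<close> is also a current on \<open>D'\<close>, and grounding it at \<open>u\<close> instead of \<open>x\<close> does not
  decrease its energy.
\<close>

lemma bottleneck_spectral_radius_mono:
  assumes x: "x \<in> pverts T" and u: "u \<in> pverts T"
    and D: "D \<in> branches T x" and D': "D' \<in> branches T u" and sub: "D \<subseteq> D'"
  shows "real_spectral_radius (bottleneck_matrix T W s vs x D) \<le>
    real_spectral_radius (bottleneck_matrix T W s vs u D')"
  unfolding bottleneck_spectral_radius_le_iff[OF x D]
proof (intro ballI impI)
  fix f assume f: "f \<in> carrier_vec N" "supported_on (I D) f"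
  have "u \<notin> D" using branch_subset[OF D'] sub by auto
  then have "f \<bullet> potential x f \<le> f \<bullet> potential u f"
    by (rule potential_energy_mono[OF x u _ D f])
  also have "\<dots> \<le> real_spectral_radius (bottleneck_matrix T W s vs u D') * (f \<bullet> f)"
    using bottleneck_spectral_radius_le_iff[OF u D'] supported_on_mono[OF f(2) I_mono[OF sub]] f(1) by blast
  finally show "f \<bullet> potential x f \<le> real_spectral_radius (bottleneck_matrix T W s vs u D') * (f \<bullet> f)" .
qed

end

section \<open>The direction of the Perron branches\<close>

locale uniquely_perron_tree = weighted_tree +
  assumes unique_perron: "x \<in> pverts T \<Longrightarrow> \<exists>!B. perron_branch T W s vs x B"
begin

abbreviation rho :: "'a \<Rightarrow> 'a set \<Rightarrow> real" where
  "rho x D \<equiv> real_spectral_radius (bottleneck_matrix T W s vs x D)"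

abbreviation perron :: "'a \<Rightarrow> 'a set \<Rightarrow> bool" where
  "perron \<equiv> perron_branch T W s vs"

abbreviation mutual :: "'a \<Rightarrow> 'a \<Rightarrow> bool" where
  "mutual \<equiv> mutual_perron T W s vs"

lemma perron_is_branch: "perron x B \<Longrightarrow> B \<in> branches T x"
  by (simp add: perron_branch_def)

lemma perron_unique: "x \<in> pverts T \<Longrightarrow> perron x B \<Longrightarrow> perron x B' \<Longrightarrow> B = B'"
  using unique_perron by blast

text \<open>
  The spectral radius of a branch never exceeds that of the whole inverse, and equality would
  make it a second Perron branch.
\<close>

lemma rho_less_perron:
  assumes x: "x \<in> pverts T" and B: "perron x B" and D: "D \<in> branches T x" "D \<noteq> B"
  shows "rho x D < rho x B"
proof -
  have "\<not> perron x D" using perron_unique[OF x B] D(2) by blast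
  then show ?thesis
    using bottleneck_spectral_radius_le[OF x D(1)] B D(1) by (simp add: perron_branch_def)
qed

text \<open>
  For a branch \<open>C\<close> at \<open>x\<close> without \<open>u\<close>, the chain \<open>\<rho>\<^sub>x(C) \<le> \<rho>\<^sub>u(D') < \<rho>\<^sub>u(B') \<le> \<rho>\<^sub>x(E)\<close>
  compares it with the branch \<open>E\<close> towards \<open>u\<close>, where \<open>D'\<close> is the branch at \<open>u\<close> that contains
  \<open>x\<close>.
\<close>

lemma perron_towards_mutual_outside:
  assumes uv: "(u, v) \<in> parcs T" and B': "perron u B'" "v \<in> B'"
    and x: "x \<in> pverts T" "x \<noteq> u" "x \<notin> B'" and C: "perron x C"
  shows "u \<in> C"
proof (rule ccontr)
  assume "u \<notin> C"
  have V: "u \<in> pverts T" "v \<in> pverts T" using uv in_arcsD1 in_arcsD2 by blast+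
  have C_branch: "C \<in> branches T x" and B'_branch: "B' \<in> branches T u"
    using C B' perron_is_branch by blast+
  obtain D' where D': "D' \<in> branches T u" "x \<in> D'" using branch_exists[OF x(1,2)] by blast
  have "C \<subseteq> D'" by (rule branch_subset_branch_containing[OF C_branch \<open>u \<notin> C\<close> D'])
  then have "rho x C \<le> rho u D'"
    by (rule bottleneck_spectral_radius_mono[OF x(1) V(1) C_branch D'(1)])
  also have "\<dots> < rho u B'" using D'(2) x(3) by (intro rho_less_perron[OF V(1) B'(1) D'(1)]) auto
  also have "\<dots> \<le> rho x E" if E: "E \<in> branches T x" "u \<in> E" for E
    using branch_subset_branch_containing[OF B'_branch x(3) E]
    by (rule bottleneck_spectral_radius_mono[OF V(1) x(1) B'_branch E(1)])
  finally have less: "rho x C < rho x E" if "E \<in> branches T x" "u \<in> E" for E using that .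
  obtain E where E: "E \<in> branches T x" "u \<in> E" using branch_exists[of u x] V(1) x(2) by metis
  have "E \<noteq> C" using E(2) \<open>u \<notin> C\<close> by blast
  then have "rho x E < rho x C" by (rule rho_less_perron[OF x(1) C E(1)])
  with less[OF E] show False by simp
qed

text \<open>
  The two Perron branches along the edge are disjoint, so \<open>x\<close> lies outside one of them.
\<close>

lemma perron_contains_mutual:
  assumes uv: "mutual u v" and x: "x \<in> pverts T" and C: "perron x C"
  shows "u \<in> C \<or> v \<in> C"
proof -
  have arc: "(u, v) \<in> parcs T" using uv by (simp add: mutual_perron_def)
  obtain B' where B': "perron u B'" "v \<in> B'" using uv by (auto simp: mutual_perron_def)
  obtain B where B: "perron v B" "u \<in> B" using uv by (auto simp: mutual_perron_def)
  consider "x = u" | "x = v" | "x \<noteq> u" "x \<noteq> v" by blast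
  then show ?thesis
  proof cases
    case 1 then show ?thesis using perron_unique[OF x C] B' by blast
  next
    case 2 then show ?thesis using perron_unique[OF x C] B by blast
  next
    case 3
    have "B \<inter> B' = {}"
      using opposite_branches_disjoint[OF arc _ B(2) _ B'(2)] B(1) B'(1) perron_is_branch by blast
    then consider "x \<notin> B'" | "x \<notin> B" by blast
    then show ?thesis
      using perron_towards_mutual_outside[OF arc B' x 3(1) _ C]
        perron_towards_mutual_outside[OF arc_sym[OF arc] B x 3(2) _ C] by cases auto
  qed
qed

lemma perron_iff_contains_mutual:
  assumes uv: "mutual u v" and x: "x \<in> pverts T" and D: "D \<in> branches T x"
  shows "perron x D \<longleftrightarrow> u \<in> D \<or> v \<in> D"
proof
  assume "perron x D"
  then show "u \<in> D \<or> v \<in> D" by (rule perron_contains_mutual[OF uv x])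
next
  assume D_uv: "u \<in> D \<or> v \<in> D"
  have arc: "(u, v) \<in> parcs T" using uv by (simp add: mutual_perron_def)
  \<comment> \<open>Away from the edge, \<open>u\<close> and \<open>v\<close> lie in the same branch at \<open>x\<close>.\<close>
  have same: "v \<in> E \<longleftrightarrow> u \<in> E" if "E \<in> branches T x" "x \<noteq> u" "x \<noteq> v" for E
    using branch_closed[OF that(1) _ arc] branch_closed[OF that(1) _ arc_sym[OF arc]] that(2,3) by blast
  obtain C where C: "perron x C" using unique_perron[OF x] by blast
  have "C \<in> branches T x" by (rule perron_is_branch[OF C])
  have notin: "x \<notin> C" "x \<notin> D" using branch_subset \<open>C \<in> branches T x\<close> D by blast+
  have "\<exists>a. a \<in> C \<and> a \<in> D"
    using perron_contains_mutual[OF uv x C] D_uv notin same[OF \<open>C \<in> branches T x\<close>] same[OF D] by metis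
  then have "D = C" using branch_unique[OF D \<open>C \<in> branches T x\<close>] by blast
  with C show "perron x D" by simp
qed

text \<open>
  A smallest Perron branch and the neighbour in it form such a pair: a Perron branch at the
  neighbour that points away would be smaller.
\<close>

lemma mutual_exists: "\<exists>u v. mutual u v"
proof -
  define P where "P x = (THE B. perron x B)" for x
  have P: "perron x (P x)" if "x \<in> pverts T" for x
    unfolding P_def using unique_perron[OF that] by (rule theI')
  have "pverts T \<noteq> {}" using tree by (auto simp: tree_graph_def connected_conv)
  then obtain x where x: "x \<in> pverts T" and min: "\<And>y. y \<in> pverts T \<Longrightarrow> card (P x) \<le> card (P y)"
    using ex_has_least_nat[of "\<lambda>y. y \<in> pverts T" _ "\<lambda>y. card (P y)"] by blast
  have Px: "P x \<in> branches T x" using P[OF x] by (rule perron_is_branch)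
  obtain y where y: "y \<in> P x" "(x, y) \<in> parcs T" using branch_has_neighbour[OF Px x] by blast
  then have yV: "y \<in> pverts T" by (auto dest: in_arcsD2)
  have Py: "P y \<in> branches T y" using P[OF yV] by (rule perron_is_branch)
  have "x \<in> P y"
  proof (rule ccontr)
    assume "x \<notin> P y"
    then have "P y \<subseteq> P x" by (rule branch_subset_branch_containing[OF Py _ Px y(1)])
    moreover have "y \<notin> P y" using branch_subset[OF Py] by blast
    ultimately have "P y \<subset> P x" using y(1) by blast
    moreover have "finite (P x)" using branch_subset[OF Px] pair_finite_verts finite_subset by blast
    ultimately have "card (P y) < card (P x)" by (rule psubset_card_mono[rotated])
    with min[OF yV] show False by simp
  qed
  then have "mutual x y" using P[OF x] P[OF yV] y by (auto simp: mutual_perron_def)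
  then show ?thesis by blast
qed

text \<open>
  The disjoint branches \<open>B\<close> and \<open>B'\<close> at the two ends are joined by the edge \<open>{u, v}\<close> only, and
  each contains an end of \<open>{u', v'}\<close>.
\<close>

lemma mutual_unique:
  assumes uv: "mutual u v" and uv': "mutual u' v'"
  shows "{u', v'} = {u, v}"
proof -
  have arc: "(u, v) \<in> parcs T" and arc': "(u', v') \<in> parcs T"
    using uv uv' by (simp_all add: mutual_perron_def)
  have V: "u \<in> pverts T" "v \<in> pverts T" using arc in_arcsD1 in_arcsD2 by blast+
  obtain B' where B': "perron u B'" "v \<in> B'" using uv by (auto simp: mutual_perron_def)
  obtain B where B: "perron v B" "u \<in> B" using uv by (auto simp: mutual_perron_def)
  have disj: "B \<inter> B' = {}"
    using opposite_branches_disjoint[OF arc _ B(2) _ B'(2)] B(1) B'(1) perron_is_branch by blast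
  have crossing: "a = v \<and> b = u" if "(a, b) \<in> parcs T" "a \<in> B'" "b \<in> B" for a b
  proof
    show "a = v"
      using branch_closed[OF perron_is_branch[OF B(1)] that(3) arc_sym[OF that(1)]] disj that(2) by blast
    show "b = u"
      using branch_closed[OF perron_is_branch[OF B'(1)] that(2,1)] disj that(3) by blast
  qed
  have "u' \<in> B' \<or> v' \<in> B'" by (rule perron_contains_mutual[OF uv' V(1) B'(1)])
  moreover have "u' \<in> B \<or> v' \<in> B" by (rule perron_contains_mutual[OF uv' V(2) B(1)])
  ultimately show ?thesis
    using crossing[OF arc'] crossing[OF arc_sym[OF arc']] disj by blast
qed

end

theorem theorem3p5:
  fixes T :: "'a pair_pre_digraph"
    and W :: "'a set \<Rightarrow> real mat"
    and s :: nat
    and vs :: "'a list"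
  assumes "tree_graph T"
    and "1 \<le> s"
    and "\<And>u v. (u, v) \<in> parcs T \<Longrightarrow> pos_def_mat s (W {u, v})"
    and "distinct vs" and "set vs = pverts T"
    and "\<And>x. x \<in> pverts T \<Longrightarrow> \<exists>!B. perron_branch T W s vs x B"
  shows "(\<exists>!e. \<exists>u v. e = {u, v} \<and> mutual_perron T W s vs u v) \<and>
    (\<forall>u v. mutual_perron T W s vs u v \<longrightarrow>
      (\<forall>x \<in> pverts T. \<forall>B \<in> branches T x.
        perron_branch T W s vs x B \<longleftrightarrow> u \<in> B \<or> v \<in> B))"
proof -
  interpret uniquely_perron_tree T W s vs
    by unfold_locales (use assms in blast)+
  obtain u v where uv: "mutual u v" using mutual_exists by blast
  have "\<exists>!e. \<exists>u v. e = {u, v} \<and> mutual u v"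
    using uv mutual_unique[OF uv] by (intro ex1I[of _ "{u, v}"]) blast+
  then show ?thesis using perron_iff_contains_mutual by blast
qed

end
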